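(* Let $X$ be a Banach space, $l\in\mathbb{N}$, and let $(e^1_n)_n,\ldots,(e^l_n)_n$ be seminormalized sequences in $X$ such that each one is either weakly null, or equivalent to the unit vector basis of $\ell_1$, or non-trivial weak-Cauchy. Let $I\subset\{1,\ldots,l\}$ be the set of those $i$ for which $(e^i_n)_n$ is non-trivial weak-Cauchy, let $e^{**}_i=w^*\text{-}\lim_n e^i_n\in X^{**}$ for $i\in I$, and set $F=\mathrm{span}\{e^{**}_i: i\in I\}\subset X^{**}$ (where $X$ is identified with its canonical image in $X^{**}$). Then there exists a plegma family $(s_i)_{i=1}^l$ in $[\mathbb{N}]^\infty$ such that $\{e^i_{s_i(n)}\}_{i=1,n\in\mathbb{N}}^l$, enumerated by the natural plegma order, is a Schauder basic sequence if and only if $X\cap F=\{0\}$.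
   Context: A sequence $(x_n)_n$ is non-trivial weak-Cauchy if there exists $x^{**}\in X^{**}\setminus X$ with $w^*\text{-}\lim x_n=x^{**}$. Infinite subsets of $\mathbb{N}$ are identified with their increasing enumerations: for $s\in[\mathbb{N}]^\infty$ (the infinite subsets of $\mathbb{N}$), $s(1)<s(2)<\cdots$ are its elements. A plegma family in $[\mathbb{N}]^\infty$ is a finite sequence $(s_i)_{i=1}^l$ of infinite subsets of $\mathbb{N}$ such that (i) $s_{i_1}(j_1)<s_{i_2}(j_2)$ for all $j_1<j_2$ in $\mathbb{N}$ and all $1\le i_1,i_2\le l$, and (ii) $s_{i_1}(j)\le s_{i_2}(j)$ for all $1\le i_1<i_2\le l$ and $j\in\mathbb{N}$. The natural plegma order on $\{e^i_{s_i(n)}\}$ is the lexicographic order on the pairs $(n,i)\in\mathbb{N}\times\{1,\ldots,l\}$, i.e. $e^1_{s_1(1)},e^2_{s_2(1)},\ldots,e^l_{s_l(1)},e^1_{s_1(2)},\ldots$. *)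

theory Defs
  imports "HOL-Analysis.Analysis"
begin

definition canon :: "'a::real_normed_vector \<Rightarrow> ('a \<Rightarrow>\<^sub>L real) \<Rightarrow>\<^sub>L real" where
  "canon x = Blinfun (\<lambda>f. blinfun_apply f x)"

definition seminormalized :: "(nat \<Rightarrow> 'a::real_normed_vector) \<Rightarrow> bool" where
  "seminormalized x \<longleftrightarrow> (\<exists>c C. 0 < c \<and> (\<forall>n. c \<le> norm (x n) \<and> norm (x n) \<le> C))"

definition weakly_null :: "(nat \<Rightarrow> 'a::real_normed_vector) \<Rightarrow> bool" where
  "weakly_null x \<longleftrightarrow> (\<forall>f::'a \<Rightarrow>\<^sub>L real. (\<lambda>n. blinfun_apply f (x n)) \<longlonglongrightarrow> 0)"

definition l1_equiv :: "(nat \<Rightarrow> 'a::real_normed_vector) \<Rightarrow> bool" where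
  "l1_equiv x \<longleftrightarrow> (\<exists>c C. 0 < c \<and> (\<forall>(a::nat \<Rightarrow> real) n.
      c * (\<Sum>k<n. \<bar>a k\<bar>) \<le> norm (\<Sum>k<n. a k *\<^sub>R x k) \<and>
      norm (\<Sum>k<n. a k *\<^sub>R x k) \<le> C * (\<Sum>k<n. \<bar>a k\<bar>)))"

definition wstar_lim :: "(nat \<Rightarrow> 'a::real_normed_vector) \<Rightarrow> ('a \<Rightarrow>\<^sub>L real) \<Rightarrow>\<^sub>L real \<Rightarrow> bool" where
  "wstar_lim x z \<longleftrightarrow> (\<forall>f::'a \<Rightarrow>\<^sub>L real.
      (\<lambda>n. blinfun_apply (canon (x n)) f) \<longlonglongrightarrow> blinfun_apply z f)"

definition nontrivial_weak_cauchy :: "(nat \<Rightarrow> 'a::real_normed_vector) \<Rightarrow> bool" where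
  "nontrivial_weak_cauchy x \<longleftrightarrow> (\<exists>z. z \<notin> range canon \<and> wstar_lim x z)"

definition schauder_basic :: "(nat \<Rightarrow> 'a::real_normed_vector) \<Rightarrow> bool" where
  "schauder_basic x \<longleftrightarrow>
     (\<forall>y \<in> closure (span (range x)). \<exists>!a::nat \<Rightarrow> real. (\<lambda>k. a k *\<^sub>R x k) sums y)"

(* Plegma family of l infinite subsets of nat, each given by its increasing
  enumeration s i (i < l), indices 0-based. *)
definition plegma :: "nat \<Rightarrow> (nat \<Rightarrow> nat \<Rightarrow> nat) \<Rightarrow> bool" where
  "plegma l s \<longleftrightarrow> (\<forall>i<l. strict_mono (s i)) \<and>
     (\<forall>i1<l. \<forall>i2<l. \<forall>j1 j2. j1 < j2 \<longrightarrow> s i1 j1 < s i2 j2) \<and>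
     (\<forall>i1 i2 j. i1 < i2 \<and> i2 < l \<longrightarrow> s i1 j \<le> s i2 j)"

definition plegma_enum :: "nat \<Rightarrow> (nat \<Rightarrow> nat \<Rightarrow> 'a) \<Rightarrow> (nat \<Rightarrow> nat \<Rightarrow> nat) \<Rightarrow> nat \<Rightarrow> 'a" where
  "plegma_enum l e s m = e (m mod l) (s (m mod l) (m div l))"

end

theory Submission
  imports Defs
begin

text \<open>
  Necessity: a point of \<open>X \<inter> F\<close> is the weak limit of vectors whose supports, with respect to the basic
  sequence, move to infinity. It lies in the closed span, and all its coordinates vanish because the
  coordinate functionals of a basic sequence are continuous (Baire category and a
  successive-approximation argument), so it is zero.

  Sufficiency: attach to each sequence a weak-star cluster point \<open>z\<^sub>i\<close> in the bidual, namely the limit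
  \<open>e\<^sub>i\<^sup>*\<^sup>*\<close>, or \<open>0\<close> for a weakly null sequence, or, for an \<open>\<ell>\<^sub>1\<close>-sequence, a cluster point chosen
  outside \<open>X\<close> plus the span of the previous choices. Then \<open>Z = span {z\<^sub>i}\<close> is finite dimensional with
  \<open>X \<inter> Z = {0}\<close>, so \<open>\<parallel>u + z\<parallel> \<ge> c \<parallel>u\<parallel>\<close> on \<open>X \<oplus> Z\<close>. Mazur's selection then applies one index at a time:
  the new vector has to be close to \<open>z\<^sub>i\<close> on a finite set of functionals that norms the span of
  everything seen so far together with \<open>Z\<close>. The tail of a linear combination then acts on these
  functionals like an element of \<open>Z\<close>, which bounds all partial sums by the full sum.
\<close>

subsection \<open>Hahn--Banach theorems and the canonical embedding\<close>

lemma subspace_closure: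
  fixes S :: "'a::real_normed_vector set"
  assumes "subspace S"
  shows "subspace (closure S)"
proof (rule subspaceI)
  show "0 \<in> closure S"
    using subspace_0[OF assms] closure_subset by blast
next
  fix x y assume "x \<in> closure S" "y \<in> closure S"
  then obtain u v where "\<And>n. u n \<in> S" "u \<longlonglongrightarrow> x" "\<And>n. v n \<in> S" "v \<longlonglongrightarrow> y"
    unfolding closure_sequential by blast
  then have "\<And>n. u n + v n \<in> S" "(\<lambda>n. u n + v n) \<longlonglongrightarrow> x + y"
    by (auto intro: subspace_add[OF assms] tendsto_add)
  then show "x + y \<in> closure S"
    unfolding closure_sequential by (intro exI[of _ "\<lambda>n. u n + v n"]) auto
next
  fix x and c :: real assume "x \<in> closure S"
  then obtain u where "\<And>n. u n \<in> S" "u \<longlonglongrightarrow> x"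
    unfolding closure_sequential by blast
  then have "\<And>n. c *\<^sub>R u n \<in> S" "(\<lambda>n. c *\<^sub>R u n) \<longlonglongrightarrow> c *\<^sub>R x"
    by (auto intro: subspace_scale[OF assms] tendsto_intros)
  then show "c *\<^sub>R x \<in> closure S"
    unfolding closure_sequential by (intro exI[of _ "\<lambda>n. c *\<^sub>R u n"]) auto
qed

text \<open>One-dimensional extension step for a functional given by its graph \<open>M\<close>. The
  value \<open>\<alpha>\<close> at \<open>v\<close> must lie above every
  \<open>t - C * norm (x - v)\<close> and below every \<open>C * norm (x + v) - t\<close>; the
  triangle inequality keeps the two families apart, and homogeneity reduces a general
  \<open>c\<close> to \<open>1\<close> and \<open>- 1\<close>.\<close>

lemma Hahn_Banach_graph_extend:
  fixes M :: "('a::real_normed_vector \<times> real) set"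
  assumes C: "C \<ge> 0" and M: "subspace M" and dom: "\<And>x t. (x, t) \<in> M \<Longrightarrow> t \<le> C * norm x"
  shows "\<exists>\<alpha>. \<forall>x t c. (x, t) \<in> M \<longrightarrow> t + c * \<alpha> \<le> C * norm (x + c *\<^sub>R v)"
proof -
  define L where "L = (\<lambda>p::'a \<times> real. snd p - C * norm (fst p - v)) ` M"
  have 00: "(0, 0) \<in> M"
    using subspace_0[OF M] by (simp add: zero_prod_def)
  have cross: "snd p - C * norm (fst p - v) \<le> C * norm (fst q + v) - snd q"
    if "p \<in> M" "q \<in> M" for p q
  proof -
    have "(fst p + fst q, snd p + snd q) \<in> M"
      using subspace_add[OF M that] by (simp add: plus_prod_def)
    then have "snd p + snd q \<le> C * norm (fst p + fst q)"
      by (rule dom)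
    also have "\<dots> \<le> C * (norm (fst p - v) + norm (fst q + v))"
      using norm_triangle_ineq[of "fst p - v" "fst q + v"] C by (auto intro!: mult_left_mono)
    finally show ?thesis by (simp add: algebra_simps)
  qed
  have bdd: "bdd_above L"
    unfolding L_def bdd_above_def using cross[OF _ 00] by (auto intro!: exI[of _ "C * norm v"])
  define \<alpha> where "\<alpha> = Sup L"
  have lo: "t - C * norm (x - v) \<le> \<alpha>" if "(x, t) \<in> M" for x t
    unfolding \<alpha>_def using that by (intro cSup_upper[OF _ bdd]) (force simp: L_def)
  have up: "\<alpha> \<le> C * norm (x + v) - t" if "(x, t) \<in> M" for x t
    unfolding \<alpha>_def
  proof (rule cSup_least)
    show "L \<noteq> {}" using 00 by (auto simp: L_def)
    show "y \<le> C * norm (x + v) - t" if "y \<in> L" for y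
      using cross[OF _ \<open>(x, t) \<in> M\<close>] that by (auto simp: L_def)
  qed
  have "t + c * \<alpha> \<le> C * norm (x + c *\<^sub>R v)" if m: "(x, t) \<in> M" for x t c
  proof -
    consider "c = 0" | "c > 0" | "c < 0" by linarith
    then show ?thesis
    proof cases
      case 1
      then show ?thesis using dom[OF m] by simp
    next
      case 2
      have "((1 / c) *\<^sub>R x, t / c) \<in> M"
        using subspace_scale[OF M m, of "1 / c"] by simp
      then have "c * \<alpha> \<le> c * (C * norm ((1 / c) *\<^sub>R x + v) - t / c)"
        using up 2 by (intro mult_left_mono) auto
      also have "\<dots> = C * norm (c *\<^sub>R ((1 / c) *\<^sub>R x + v)) - t"
        using 2 by (simp add: right_diff_distrib)
      also have "c *\<^sub>R ((1 / c) *\<^sub>R x + v) = x + c *\<^sub>R v"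
        using 2 by (simp add: scaleR_right_distrib)
      finally show ?thesis by simp
    next
      case 3
      define d where "d = - c"
      have d: "d > 0" "c = - d" using 3 by (auto simp: d_def)
      have "((1 / d) *\<^sub>R x, t / d) \<in> M"
        using subspace_scale[OF M m, of "1 / d"] by simp
      then have "d * (t / d - C * norm ((1 / d) *\<^sub>R x - v)) \<le> d * \<alpha>"
        using lo d by (intro mult_left_mono) auto
      moreover have "d * (t / d - C * norm ((1 / d) *\<^sub>R x - v)) = t - C * norm (d *\<^sub>R ((1 / d) *\<^sub>R x - v))"
        using d by (simp add: right_diff_distrib)
      moreover have "d *\<^sub>R ((1 / d) *\<^sub>R x - v) = x + c *\<^sub>R v"
        using d by (simp add: scaleR_right_diff_distrib)
      ultimately show ?thesis using d by simp
    qed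
  qed
  then show ?thesis by blast
qed

text \<open>Zorn's lemma over dominated subspaces of the product with the reals. With graphs,
  extension is plain inclusion, and domination forces single-valuedness: a vertical vector
  \<open>(0, t)\<close> comes with \<open>(0, - t)\<close>, so \<open>t = 0\<close>.\<close>

theorem Hahn_Banach_graph:
  fixes G :: "('a::real_normed_vector \<times> real) set"
  assumes C: "C \<ge> 0" and G: "subspace G" and dom: "\<And>x t. (x, t) \<in> G \<Longrightarrow> t \<le> C * norm x"
  obtains f :: "'a \<Rightarrow>\<^sub>L real" where "norm f \<le> C" "\<And>x t. (x, t) \<in> G \<Longrightarrow> blinfun_apply f x = t"
proof -
  define \<A> where "\<A> = {M. subspace M \<and> G \<subseteq> M \<and> (\<forall>(x, t)\<in>M. t \<le> C * norm x)}"
  have "\<exists>M\<in>\<A>. \<forall>X\<in>\<A>. M \<subseteq> X \<longrightarrow> X = M"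
  proof (rule subset_Zorn_nonempty)
    show "\<A> \<noteq> {}"
      using G dom by (auto simp: \<A>_def)
  next
    fix \<C> assume ne: "\<C> \<noteq> {}" and ch: "subset.chain \<A> \<C>"
    have sub: "\<C> \<subseteq> \<A>" and lin: "\<And>X Y. X \<in> \<C> \<Longrightarrow> Y \<in> \<C> \<Longrightarrow> X \<subseteq> Y \<or> Y \<subseteq> X"
      using ch by (auto simp: subset_chain_def)
    have "subspace (\<Union>\<C>)"
    proof (rule subspaceI)
      show "0 \<in> \<Union>\<C>"
        using ne sub subspace_0 by (fastforce simp: \<A>_def)
      show "x + y \<in> \<Union>\<C>" if "x \<in> \<Union>\<C>" "y \<in> \<Union>\<C>" for x y
      proof -
        obtain X Y where XY: "X \<in> \<C>" "x \<in> X" "Y \<in> \<C>" "y \<in> Y" using \<open>x \<in> \<Union>\<C>\<close> \<open>y \<in> \<Union>\<C>\<close> by blast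
        have "subspace X" "subspace Y" using XY sub by (auto simp: \<A>_def)
        from lin[OF XY(1,3)] show ?thesis
        proof
          assume "X \<subseteq> Y"
          then have "x + y \<in> Y" using XY \<open>subspace Y\<close> by (blast intro: subspace_add)
          then show ?thesis using XY by blast
        next
          assume "Y \<subseteq> X"
          then have "x + y \<in> X" using XY \<open>subspace X\<close> by (blast intro: subspace_add)
          then show ?thesis using XY by blast
        qed
      qed
      show "c *\<^sub>R x \<in> \<Union>\<C>" if "x \<in> \<Union>\<C>" for c x
      proof -
        obtain X where X: "X \<in> \<C>" "x \<in> X" using \<open>x \<in> \<Union>\<C>\<close> by blast
        then have "subspace X" using sub by (auto simp: \<A>_def)
        then show ?thesis using X subspace_scale by blast
      qed
    qed
    moreover have "G \<subseteq> \<Union>\<C>" using ne sub by (auto simp: \<A>_def)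
    moreover have "\<forall>(x, t)\<in>\<Union>\<C>. t \<le> C * norm x" using sub by (auto simp: \<A>_def)
    ultimately show "\<Union>\<C> \<in> \<A>" by (simp add: \<A>_def)
  qed
  then obtain M where MA: "M \<in> \<A>" and max: "\<And>X. X \<in> \<A> \<Longrightarrow> M \<subseteq> X \<Longrightarrow> X = M" by blast
  have M: "subspace M" "G \<subseteq> M" and domM: "\<And>x t. (x, t) \<in> M \<Longrightarrow> t \<le> C * norm x"
    using MA by (auto simp: \<A>_def)
  have total: "\<exists>t. (v, t) \<in> M" for v
  proof -
    obtain \<alpha> where \<alpha>: "\<And>x t c. (x, t) \<in> M \<Longrightarrow> t + c * \<alpha> \<le> C * norm (x + c *\<^sub>R v)"
      using Hahn_Banach_graph_extend[OF C M(1) domM] by blast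
    \<comment> \<open>Adjoining \<open>(v, \<alpha>)\<close> preserves domination, so maximality
      gives \<open>X = M\<close> and \<open>v\<close> already lies in the domain.\<close>
    define X where "X = {m + w |m w. m \<in> M \<and> w \<in> span {(v, \<alpha>)}}"
    have "X \<in> \<A>"
      unfolding \<A>_def
    proof (intro CollectI conjI)
      show "subspace X" unfolding X_def by (intro subspace_sums M subspace_span)
      show "G \<subseteq> X"
      proof
        fix g assume "g \<in> G"
        then have "g = g + 0" "g \<in> M" "0 \<in> span {(v, \<alpha>)}" using M by (auto simp: span_zero)
        then show "g \<in> X" unfolding X_def by blast
      qed
      show "\<forall>(x, t)\<in>X. t \<le> C * norm x"
        using \<alpha> by (auto simp: X_def span_singleton)
    qed
    moreover have "M \<subseteq> X"
    proof
      fix g assume "g \<in> M"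
      then have "g = g + 0" "0 \<in> span {(v, \<alpha>)}" by (auto simp: span_zero)
      then show "g \<in> X" unfolding X_def using \<open>g \<in> M\<close> by blast
    qed
    ultimately have "X = M" by (rule max)
    have "(v, \<alpha>) = 0 + (v, \<alpha>)" "(v, \<alpha>) \<in> span {(v, \<alpha>)}" by (auto simp: span_base)
    then have "(v, \<alpha>) \<in> X" unfolding X_def using subspace_0[OF M(1)] by blast
    then show ?thesis using \<open>X = M\<close> by blast
  qed
  have unique: "s = t" if "(x, s) \<in> M" "(x, t) \<in> M" for x s t
    using domM[of 0 "s - t"] domM[of 0 "t - s"] subspace_diff[OF M(1) that]
      subspace_diff[OF M(1) that(2,1)] by simp
  obtain F where F: "\<And>v. (v, F v) \<in> M" using total by metis
  have "bounded_linear F"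
  proof (rule bounded_linear_intro)
    show "F (x + y) = F x + F y" for x y
      using subspace_add[OF M(1) F F, of x y] by (intro unique[OF F]) simp
    show "F (c *\<^sub>R x) = c *\<^sub>R F x" for c x
      using subspace_scale[OF M(1) F, of c x] by (intro unique[OF F]) simp
    show "norm (F x) \<le> norm x * C" for x
      using domM[OF F, of x] domM[of "- x" "- F x"] subspace_neg[OF M(1) F, of x] C
      by (simp add: abs_le_iff mult.commute)
  qed
  then have app: "blinfun_apply (Blinfun F) = F" by (rule bounded_linear_Blinfun_apply)
  have "norm (Blinfun F) \<le> C"
  proof (rule norm_blinfun_bound[OF C])
    show "norm (blinfun_apply (Blinfun F) x) \<le> C * norm x" for x
      using domM[OF F, of x] domM[of "- x" "- F x"] subspace_neg[OF M(1) F, of x]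
      by (simp add: app abs_le_iff)
  qed
  moreover have "blinfun_apply (Blinfun F) x = t" if "(x, t) \<in> G" for x t
    using M(2) unique[OF F] that by (auto simp: app)
  ultimately show ?thesis by (rule that)
qed

lemma span_range_nat:
  fixes x :: "nat \<Rightarrow> 'a::real_vector"
  shows "span (range x) = {\<Sum>k<n. a k *\<^sub>R x k |a n. True}" (is "_ = ?R")
proof
  show "?R \<subseteq> span (range x)"
    by clarify (intro span_sum span_scale span_base rangeI)
  \<comment> \<open>Zero padding brings two combinations to a common length, so that their
    coefficients can be added.\<close>
  have pad: "(\<Sum>k<n. a k *\<^sub>R x k) = (\<Sum>k<n + m. (if k < n then a k else 0) *\<^sub>R x k)" for a n m
    by (rule sum.mono_neutral_cong_left) auto
  have "subspace ?R"
  proof (rule subspaceI)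
    show "0 \<in> ?R" by (rule CollectI, rule exI[of _ "\<lambda>_. 0"], rule exI[of _ 0]) simp
    show "y + z \<in> ?R" if "y \<in> ?R" "z \<in> ?R" for y z
    proof -
      obtain a n b m where yz: "y = (\<Sum>k<n. a k *\<^sub>R x k)" "z = (\<Sum>k<m. b k *\<^sub>R x k)"
        using \<open>y \<in> ?R\<close> \<open>z \<in> ?R\<close> by blast
      have "y + z = (\<Sum>k<n + m. ((if k < n then a k else 0) + (if k < m then b k else 0)) *\<^sub>R x k)"
        unfolding yz pad[of a n m] pad[of b m n] add.commute[of m n]
        by (simp add: sum.distrib scaleR_left_distrib)
      then show ?thesis
        by (intro CollectI exI[of _ "\<lambda>k. (if k < n then a k else 0) + (if k < m then b k else 0)"]
            exI[of _ "n + m"]) simp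
    qed
    show "c *\<^sub>R y \<in> ?R" if "y \<in> ?R" for c y
    proof -
      obtain a n where "y = (\<Sum>k<n. a k *\<^sub>R x k)" using \<open>y \<in> ?R\<close> by blast
      then have "c *\<^sub>R y = (\<Sum>k<n. (c * a k) *\<^sub>R x k)" by (simp add: scaleR_sum_right)
      then show ?thesis
        by (intro CollectI exI[of _ "\<lambda>k. c * a k"] exI[of _ n]) simp
    qed
  qed
  moreover have "range x \<subseteq> ?R"
  proof clarify
    fix j
    have "x j = (\<Sum>k<Suc j. (if k = j then 1 else 0) *\<^sub>R x k)"
      by (simp add: sum.If_cases if_distrib[of "\<lambda>t. t *\<^sub>R _"] cong: if_cong)
    then show "\<exists>a n. x j = (\<Sum>k<n. a k *\<^sub>R x k) \<and> True"
      by (intro exI[of _ "\<lambda>k. if k = j then 1 else 0"] exI[of _ "Suc j"]) simp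
  qed
  ultimately show "span (range x) \<subseteq> ?R" by (rule span_minimal[rotated])
qed

text \<open>Helly-type extension: the pairs \<open>(x k, v k)\<close> span a subspace of the
  product, and the inequality says that this subspace is dominated, hence a graph. It turns
  estimates on finite combinations into functionals with prescribed values.\<close>

lemma Hahn_Banach_moment:
  fixes x :: "nat \<Rightarrow> 'a::real_normed_vector" and v :: "nat \<Rightarrow> real"
  assumes "C \<ge> 0" and "\<And>a n. (\<Sum>k<n. a k * v k) \<le> C * norm (\<Sum>k<n. a k *\<^sub>R x k)"
  obtains f :: "'a \<Rightarrow>\<^sub>L real" where "norm f \<le> C" "\<And>k. blinfun_apply f (x k) = v k"
proof -
  let ?g = "\<lambda>k. (x k, v k)"
  have *: "t \<le> C * norm y" if yt: "(y, t) \<in> span (range ?g)" for y t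
  proof -
    obtain a n where "(y, t) = (\<Sum>k<n. a k *\<^sub>R ?g k)"
      using yt unfolding span_range_nat by blast
    then have "y = (\<Sum>k<n. a k *\<^sub>R x k)" "t = (\<Sum>k<n. a k * v k)"
      by (simp_all add: prod_eq_iff fst_sum snd_sum)
    then show ?thesis using assms(2) by simp
  qed
  show thesis
  proof (rule Hahn_Banach_graph[OF assms(1) subspace_span[of "range ?g"] *])
    fix f :: "'a \<Rightarrow>\<^sub>L real"
    assume f: "norm f \<le> C" "\<And>y t. (y, t) \<in> span (range ?g) \<Longrightarrow> blinfun_apply f y = t"
    show thesis
      by (rule that[OF f(1)]) (intro f(2) span_base rangeI)
  qed
qed

lemma Hahn_Banach_norming:
  fixes x :: "'a::real_normed_vector"
  obtains f :: "'a \<Rightarrow>\<^sub>L real" where "norm f \<le> 1" "blinfun_apply f x = norm x"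
proof (rule Hahn_Banach_graph[of 1, OF _ subspace_span[of "{(x, norm x)}"]])
  show "t \<le> 1 * norm y" if "(y, t) \<in> span {(x, norm x)}" for y t
    using that by (auto simp: span_singleton intro!: mult_right_mono)
  fix f :: "'a \<Rightarrow>\<^sub>L real"
  assume "norm f \<le> 1" and f: "\<And>y t. (y, t) \<in> span {(x, norm x)} \<Longrightarrow> blinfun_apply f y = t"
  with f[OF span_base] show thesis by (intro that) auto
qed simp

text \<open>The graph generated by \<open>S \<times> {0}\<close> and \<open>(x, 1)\<close> is
  dominated with constant \<open>1 / d\<close>, where \<open>d > 0\<close> bounds the distance from
  \<open>x\<close> to \<open>S\<close> from below.\<close>

lemma Hahn_Banach_separation:
  fixes x :: "'a::real_normed_vector"
  assumes S: "subspace S" and x: "x \<notin> closure S"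
  obtains f :: "'a \<Rightarrow>\<^sub>L real" where "\<And>y. y \<in> S \<Longrightarrow> blinfun_apply f y = 0" "blinfun_apply f x = 1"
proof -
  obtain d where d: "d > 0" "\<And>y. y \<in> S \<Longrightarrow> d \<le> norm (y - x)"
    using x unfolding closure_approachable by (metis dist_norm not_le)
  let ?G = "{p + q |p q. p \<in> S \<times> {0} \<and> q \<in> span {(x, 1::real)}}"
  have sub0: "subspace (S \<times> {0::real})"
    by (intro subspace_Times S) simp
  have *: "t \<le> 1 / d * norm y" if "(y, t) \<in> ?G" for y t
  proof -
    obtain s where s: "s \<in> S" "y = s + t *\<^sub>R x"
      using \<open>(y, t) \<in> ?G\<close> unfolding span_singleton by force
    show ?thesis
    proof (cases "t = 0")
      case False
      have "d \<le> norm ((- (1 / t)) *\<^sub>R s - x)"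
        using s by (intro d(2) subspace_scale[OF S])
      also have "(- (1 / t)) *\<^sub>R s - x = (- (1 / t)) *\<^sub>R y"
        using False by (simp add: s scaleR_right_distrib)
      also have "norm \<dots> = norm y / \<bar>t\<bar>" by simp
      finally have "\<bar>t\<bar> * d \<le> norm y" using False by (simp add: field_simps)
      moreover have "t * d \<le> \<bar>t\<bar> * d" using d(1) by (intro mult_right_mono) auto
      ultimately have "t * d \<le> norm y" by linarith
      then show ?thesis using d(1) by (simp add: field_simps)
    qed (use d in simp)
  qed
  have in_G: "p + q \<in> ?G" if "p \<in> S \<times> {0}" "q \<in> span {(x, 1)}" for p q
    using that by blast
  show thesis
  proof (rule Hahn_Banach_graph[of "1 / d" ?G, OF _ subspace_sums[OF sub0 subspace_span[of "{(x, 1)}"]] *])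
    fix f :: "'a \<Rightarrow>\<^sub>L real"
    assume f: "\<And>y t. (y, t) \<in> ?G \<Longrightarrow> blinfun_apply f y = t"
    show thesis
    proof (rule that)
    show "blinfun_apply f y = 0" if "y \<in> S" for y
      using in_G[of "(y, 0)" 0] that by (intro f) (simp add: span_zero)
    show "blinfun_apply f x = 1"
      using in_G[of 0 "(x, 1)"] subspace_0[OF sub0] by (intro f) (simp add: span_base)
    qed
  qed (use d in simp)
qed

lemma canon_apply [simp]: "blinfun_apply (canon x) f = blinfun_apply f x"
  unfolding canon_def
  by (simp add: bounded_linear_Blinfun_apply blinfun.bounded_linear_left)

lemma linear_canon: "linear canon"
  by (rule linearI) (auto intro!: blinfun_eqI simp: blinfun.bilinear_simps)

lemma norm_canon [simp]: "norm (canon x) = norm x"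
proof (rule antisym)
  have "norm (blinfun_apply f x) \<le> norm x * norm f" for f :: "'a \<Rightarrow>\<^sub>L real"
    using norm_blinfun[of f x] by (simp add: mult.commute)
  then show "norm (canon x) \<le> norm x"
    by (intro norm_blinfun_bound) auto
  obtain f :: "'a \<Rightarrow>\<^sub>L real" where "norm f \<le> 1" "blinfun_apply f x = norm x"
    by (rule Hahn_Banach_norming)
  then show "norm x \<le> norm (canon x)"
    using norm_blinfun[of "canon x" f] mult_left_le[of "norm f" "norm (canon x)"] by simp
qed

text \<open>An isometric image of a complete space is complete. Closedness later gives the unit
  sphere of a finite-dimensional complement a positive distance from this image.\<close>

lemma closed_range_canon: "closed (range (canon :: 'a::banach \<Rightarrow> _))"
proof -
  have bl: "bounded_linear (canon :: 'a \<Rightarrow> _)"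
    by (rule bounded_linear_intro[of _ 1]) (simp_all add: linear_add[OF linear_canon] linear_scale[OF linear_canon])
  show ?thesis
    by (rule complete_imp_closed, rule complete_isometric_image[of 1])
       (auto simp: bl complete_UNIV)
qed

subsection \<open>Schauder basic sequences\<close>

text \<open>Grunblum's criterion. Each term is a difference of consecutive partial sums, so each
  coordinate is bounded on finite combinations and extends to a biorthogonal functional. The
  operators \<open>P n\<close> are then uniformly bounded and converge to the identity on the span,
  hence on its closure.\<close>

lemma schauder_basicI:
  fixes x :: "nat \<Rightarrow> 'a::real_normed_vector"
  assumes nz: "\<And>k. x k \<noteq> 0"
    and K: "\<And>a m n. m \<le> n \<Longrightarrow> norm (\<Sum>k<m. a k *\<^sub>R x k) \<le> K * norm (\<Sum>k<n. a k *\<^sub>R x k)"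
  shows "schauder_basic x"
proof -
  have "norm (x 0) \<le> K * norm (x 0)"
    using K[of 1 1 "\<lambda>_. 1"] by simp
  then have K1: "K \<ge> 1" using nz[of 0] by simp
  have "\<exists>f::'a \<Rightarrow>\<^sub>L real. \<forall>k. blinfun_apply f (x k) = (if k = j then 1 else 0)" for j
  proof (rule Hahn_Banach_moment)
    show "0 \<le> 2 * K / norm (x j)" using K1 by simp
    fix a n
    show "(\<Sum>k<n. a k * (if k = j then 1 else 0)) \<le> 2 * K / norm (x j) * norm (\<Sum>k<n. a k *\<^sub>R x k)"
    proof (cases "j < n")
      case True
      have "\<bar>a j\<bar> * norm (x j) = norm ((\<Sum>k<Suc j. a k *\<^sub>R x k) - (\<Sum>k<j. a k *\<^sub>R x k))" by simp
      also have "\<dots> \<le> 2 * K * norm (\<Sum>k<n. a k *\<^sub>R x k)"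
        using K[of "Suc j" n a] K[of j n a] True
          norm_triangle_ineq4[of "\<Sum>k<Suc j. a k *\<^sub>R x k" "\<Sum>k<j. a k *\<^sub>R x k"] by linarith
      finally have "\<bar>a j\<bar> \<le> 2 * K * norm (\<Sum>k<n. a k *\<^sub>R x k) / norm (x j)"
        using nz by (simp add: field_simps)
      then show ?thesis using True by (simp add: if_distrib cong: if_cong)
    next
      case False
      then have "(\<Sum>k<n. a k * (if k = j then 1 else 0)) = 0" by (intro sum.neutral) auto
      then show ?thesis using K1 by simp
    qed
  qed blast
  then obtain \<phi> :: "nat \<Rightarrow> 'a \<Rightarrow>\<^sub>L real"
    where \<phi>: "\<And>j k. blinfun_apply (\<phi> j) (x k) = (if k = j then 1 else 0)"
    using choice[of "\<lambda>j f. \<forall>k. blinfun_apply f (x k) = (if k = j then 1 else 0)"] by blast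
  define P where "P n y = (\<Sum>k<n. blinfun_apply (\<phi> k) y *\<^sub>R x k)" for n y
  have P_diff: "P n (y - z) = P n y - P n z" for n y z
    by (simp add: P_def blinfun.diff_right scaleR_left_diff_distrib sum_subtractf)
  have P_sum: "P n (\<Sum>k<N. a k *\<^sub>R x k) = (\<Sum>k<min n N. a k *\<^sub>R x k)" for n N a
  proof -
    have "blinfun_apply (\<phi> j) (\<Sum>k<N. a k *\<^sub>R x k) = (if j < N then a j else 0)" for j
      by (simp add: blinfun.sum_right blinfun.scaleR_right \<phi> if_distrib cong: if_cong)
    then show ?thesis
      unfolding P_def by (intro sum.mono_neutral_cong_right) auto
  qed
  have P_span: "norm (P n v) \<le> K * norm v" if v: "v \<in> span (range x)" for n v
  proof -
    obtain a N where "v = (\<Sum>k<N. a k *\<^sub>R x k)" using v unfolding span_range_nat by blast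
    then show ?thesis using P_sum K[of "min n N" N a] by simp
  qed
  let ?Y = "closure (span (range x))"
  have P_bound: "norm (P n y) \<le> K * norm y" if y: "y \<in> ?Y" for n y
  proof -
    obtain v where v: "\<And>i. v i \<in> span (range x)" "v \<longlonglongrightarrow> y"
      using y unfolding closure_sequential by blast
    have "(\<lambda>i. norm (P n (v i))) \<longlonglongrightarrow> norm (P n y)"
      unfolding P_def by (intro tendsto_intros v)
    moreover have "(\<lambda>i. K * norm (v i)) \<longlonglongrightarrow> K * norm y" by (intro tendsto_intros v)
    ultimately show ?thesis
      by (rule LIMSEQ_le) (use P_span[OF v(1)] in blast)
  qed
  have P_lim: "(\<lambda>n. P n y) \<longlonglongrightarrow> y" if y: "y \<in> ?Y" for y
  proof (rule LIMSEQ_I)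
    fix e :: real assume "e > 0"
    then have "e / (K + 1) > 0" using K1 by simp
    then obtain v where v: "v \<in> span (range x)" "norm (v - y) < e / (K + 1)"
      using y unfolding closure_approachable dist_norm by blast
    obtain a N where a: "v = (\<Sum>k<N. a k *\<^sub>R x k)" using v(1) unfolding span_range_nat by blast
    have "norm (P n y - y) < e" if "n \<ge> N" for n
    proof -
      \<comment> \<open>Combinations of length at most \<open>n\<close> are fixed by
        \<open>P n\<close>, so only the approximation error \<open>y - v\<close> remains.\<close>
      have "P n v = v" using that by (simp add: a P_sum min_absorb2)
      then have "P n y - y = P n (y - v) - (y - v)" by (simp add: P_diff)
      also have "norm \<dots> \<le> norm (P n (y - v)) + norm (y - v)" by (rule norm_triangle_ineq4)
      also have "\<dots> \<le> K * norm (y - v) + norm (y - v)"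
        using v(1) y closure_subset
        by (intro add_right_mono P_bound subspace_diff[OF subspace_closure[OF subspace_span]]) auto
      also have "\<dots> = (K + 1) * norm (v - y)" by (simp add: algebra_simps norm_minus_commute)
      also have "\<dots> < e" using v(2) K1 by (simp add: field_simps)
      finally show ?thesis .
    qed
    then show "\<exists>no. \<forall>n\<ge>no. norm (P n y - y) < e" by blast
  qed
  show ?thesis
    unfolding schauder_basic_def
  proof (intro ballI ex1I)
    fix y assume "y \<in> ?Y"
    then show "(\<lambda>k. blinfun_apply (\<phi> k) y *\<^sub>R x k) sums y"
      using P_lim unfolding sums_def P_def by blast
  next
    fix y a assume "(\<lambda>k. a k *\<^sub>R x k) sums y"
    then have "(\<lambda>k. blinfun_apply (\<phi> j) (a k *\<^sub>R x k)) sums blinfun_apply (\<phi> j) y" for j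
      by (rule bounded_linear.sums[OF blinfun.bounded_linear_right])
    then have "(\<lambda>k. if k = j then a j else 0) sums blinfun_apply (\<phi> j) y" for j
      by (simp add: blinfun.scaleR_right \<phi> if_distrib cong: if_cong)
    then have "blinfun_apply (\<phi> j) y = a j" for j
      using sums_single[of j "\<lambda>_. a j"] sums_unique2 by blast
    then show "a = (\<lambda>k. blinfun_apply (\<phi> k) y)" by auto
  qed
qed

section \<open>Boundedness of the partial sums when expansions in a closed subspace are
  unique\<close>

context
  fixes x :: "nat \<Rightarrow> 'a::banach" and Y :: "'a set" and A :: "'a \<Rightarrow> nat \<Rightarrow> real"
  assumes Y: "closed Y" "subspace Y"
    and A: "\<And>y. y \<in> Y \<Longrightarrow> (\<lambda>k. A y k *\<^sub>R x k) sums y"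
    and A_unique: "\<And>y a. y \<in> Y \<Longrightarrow> (\<lambda>k. a k *\<^sub>R x k) sums y \<Longrightarrow> a = A y"
begin

abbreviation "psum n y \<equiv> (\<Sum>k<n. A y k *\<^sub>R x k)"

lemma coeff_diff:
  assumes "y \<in> Y" "z \<in> Y"
  shows "A (y - z) = (\<lambda>k. A y k - A z k)"
proof -
  have "(\<lambda>k. (A y k - A z k) *\<^sub>R x k) sums (y - z)"
    unfolding scaleR_left_diff_distrib by (intro sums_diff A assms)
  then show ?thesis using A_unique[OF subspace_diff[OF Y(2) assms]] by simp
qed

lemma coeff_scale:
  assumes "y \<in> Y"
  shows "A (c *\<^sub>R y) = (\<lambda>k. c * A y k)"
proof -
  have "(\<lambda>k. (c * A y k) *\<^sub>R x k) sums (c *\<^sub>R y)"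
    using sums_scaleR_right[OF A[OF assms], of c] by simp
  then show ?thesis using A_unique[OF subspace_scale[OF Y(2) assms]] by simp
qed

lemma psum_diff: "y \<in> Y \<Longrightarrow> z \<in> Y \<Longrightarrow> psum n (y - z) = psum n y - psum n z"
  by (simp add: coeff_diff scaleR_left_diff_distrib sum_subtractf)

lemma psum_scale: "y \<in> Y \<Longrightarrow> psum n (c *\<^sub>R y) = c *\<^sub>R psum n y"
  by (simp add: coeff_scale scaleR_sum_right)

lemma psum_lim: "y \<in> Y \<Longrightarrow> (\<lambda>n. psum n y) \<longlonglongrightarrow> y"
  using A unfolding sums_def .

text \<open>A zero vector would give \<open>0\<close> two different expansions.\<close>

lemma basis_nonzero: "x k \<noteq> 0"
proof
  assume "x k = 0"
  have 0: "0 \<in> Y" by (rule subspace_0[OF Y(2)])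
  have "(\<lambda>j. (if j = k then 1 else 0) *\<^sub>R x j) = (\<lambda>_. 0)"
    using \<open>x k = 0\<close> by (intro ext) simp
  then have "(\<lambda>j. if j = k then 1 else 0) = A 0"
    using sums_zero by (intro A_unique[OF 0]) (simp only:)
  moreover have "(\<lambda>j. 0) = A 0"
    using sums_zero by (intro A_unique[OF 0]) simp
  ultimately have "(\<lambda>j. if j = k then 1 else 0 :: real) = (\<lambda>j. 0)" by (simp only:)
  then show False by (auto dest: fun_cong[of _ _ k])
qed

text \<open>Balls of the norm \<open>sup_n (norm (psum n y))\<close>. The aim is to bound this norm
  by a multiple of the given one, by running the open mapping argument on these balls
  directly.\<close>

definition psum_ball :: "real \<Rightarrow> 'a set" where
  "psum_ball r = {y \<in> Y. \<forall>n. norm (psum n y) \<le> r}"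

lemma psum_ball_diff: "y \<in> psum_ball r \<Longrightarrow> z \<in> psum_ball s \<Longrightarrow> y - z \<in> psum_ball (r + s)"
  unfolding psum_ball_def
  by (auto simp: psum_diff subspace_diff[OF Y(2)] intro!: norm_triangle_le_diff add_mono)

lemma psum_ball_scale: "y \<in> psum_ball r \<Longrightarrow> c *\<^sub>R y \<in> psum_ball (\<bar>c\<bar> * r)"
  using subspace_scale[OF Y(2)] unfolding psum_ball_def
  by (auto simp: psum_scale intro: mult_left_mono)

text \<open>Convergent partial sums are bounded, so the balls of integer radius cover
  \<open>Y\<close>. By Baire's theorem in the complete space \<open>Y\<close>, the closure of one of
  them has relative interior.\<close>

lemma psum_ball_Baire: "\<exists>N r y0. r > 0 \<and> y0 \<in> Y \<and> Y \<inter> ball y0 r \<subseteq> closure (psum_ball N)"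
proof (rule ccontr)
  assume no: "\<not> ?thesis"
  let ?T = "top_of_set Y"
  have "?T interior_of (\<Union> (range (\<lambda>N::nat. Y \<inter> closure (psum_ball N)))) = {}"
  proof (rule Baire_category_alt)
    show "completely_metrizable_space ?T \<or> locally_compact_space ?T \<and> regular_space ?T"
      using Y(1) completely_metrizable_space_closedin completely_metrizable_space_euclidean
      by (metis closed_closedin)
    show "countable (range (\<lambda>N::nat. Y \<inter> closure (psum_ball N)))" by simp
    fix T assume "T \<in> range (\<lambda>N::nat. Y \<inter> closure (psum_ball N))"
    then obtain N where T: "T = Y \<inter> closure (psum_ball (real N))" by blast
    have "?T interior_of T = {}"
    proof (rule ccontr)
      assume "?T interior_of T \<noteq> {}"
      then obtain y0 U where U: "openin ?T U" "y0 \<in> U" "U \<subseteq> T"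
        unfolding interior_of_def by blast
      then obtain r where "r > 0" "ball y0 r \<inter> Y \<subseteq> U"
        unfolding openin_contains_ball by blast
      moreover have "y0 \<in> Y" using U T by blast
      ultimately show False using no U(3) T by blast
    qed
    then show "closedin ?T T \<and> ?T interior_of T = {}"
      unfolding T by (simp add: closedin_closed_Int)
  qed
  moreover have "Y \<subseteq> \<Union> (range (\<lambda>N::nat. Y \<inter> closure (psum_ball N)))"
  proof
    fix y assume y: "y \<in> Y"
    then have "Bseq (\<lambda>n. psum n y)" using psum_lim convergent_imp_Bseq convergentI by blast
    then obtain K where "\<And>n. norm (psum n y) \<le> K" unfolding Bseq_def by blast
    moreover obtain N :: nat where "K \<le> N" using real_arch_simple by blast
    ultimately have "y \<in> psum_ball N" using y unfolding psum_ball_def by (auto intro: order_trans)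
    then show "y \<in> \<Union> (range (\<lambda>N::nat. Y \<inter> closure (psum_ball N)))"
      using y closure_subset by blast
  qed
  then have "\<Union> (range (\<lambda>N::nat. Y \<inter> closure (psum_ball N))) = topspace ?T" by auto
  ultimately have "?T interior_of (topspace ?T) = {}" by simp
  then have "Y = {}" using interior_of_topspace[of ?T] by simp
  then show False using subspace_0[OF Y(2)] by blast
qed

text \<open>Differences move the Baire ball to the origin at the cost of a factor two, and scaling
  does the rest. This only approximates \<open>y\<close> by vectors with controlled partial sums;
  \<open>psum_bounded\<close> removes the approximation.\<close>

lemma psum_ball_dense:
  obtains M where "M \<ge> 0" "\<And>y e. y \<in> Y \<Longrightarrow> e > 0 \<Longrightarrow> \<exists>u\<in>psum_ball (M * norm y). norm (y - u) < e"
proof -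
  obtain N r y0 where r: "r > 0" "y0 \<in> Y" and sub: "Y \<inter> ball y0 r \<subseteq> closure (psum_ball N)"
    using psum_ball_Baire by blast
  have "y0 \<in> closure (psum_ball N)" using sub r by auto
  then obtain w0 where "w0 \<in> psum_ball N" by (cases "psum_ball N = {}") auto
  then have N: "N \<ge> 0" unfolding psum_ball_def by (auto dest: spec[of _ 0])
  have small: "\<exists>u\<in>psum_ball (N + N). norm (y - u) < e" if y: "y \<in> Y" "norm y < r" and e: "e > 0" for y e
  proof -
    have "y0 + y \<in> Y \<inter> ball y0 r"
      using y r subspace_add[OF Y(2)] by (simp add: dist_norm)
    then obtain u where u: "u \<in> psum_ball N" "norm (u - (y0 + y)) < e / 2"
      using sub e closure_approachable[of "y0 + y" "psum_ball N"] half_gt_zero[OF e] unfolding dist_norm by blast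
    obtain v where v: "v \<in> psum_ball N" "norm (v - y0) < e / 2"
      using \<open>y0 \<in> closure (psum_ball N)\<close> half_gt_zero[OF e] unfolding closure_approachable dist_norm by blast
    have "norm (y - (u - v)) = norm ((v - y0) - (u - (y0 + y)))" by (simp add: algebra_simps)
    also have "\<dots> < e" using norm_triangle_ineq4[of "v - y0" "u - (y0 + y)"] u v by linarith
    finally show ?thesis using psum_ball_diff[OF u(1) v(1)] by blast
  qed
  have "\<exists>u\<in>psum_ball (4 * N / r * norm y). norm (y - u) < e" if y: "y \<in> Y" and e: "e > 0" for y e
  proof (cases "y = 0")
    case True
    have "A 0 = (\<lambda>k. 0)" using coeff_scale[OF y, of 0] by simp
    then have "0 \<in> psum_ball (4 * N / r * norm y)"
      using subspace_0[OF Y(2)] True by (simp add: psum_ball_def)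
    then show ?thesis using True e by force
  next
    case False
    \<comment> \<open>This scaling gives \<open>t *\<^sub>R y\<close> the norm \<open>r / 2\<close>,
      where \<open>small\<close> applies; undoing it multiplies \<open>N + N\<close> by
      \<open>2 * norm y / r\<close>.\<close>
    define t where "t = r / (2 * norm y)"
    have t: "t > 0" using r False by (simp add: t_def)
    have "norm (t *\<^sub>R y) < r" using t r False by (simp add: t_def)
    then obtain u where u: "u \<in> psum_ball (N + N)" "norm (t *\<^sub>R y - u) < t * e"
      using small[of "t *\<^sub>R y" "t * e"] subspace_scale[OF Y(2) y] t e by auto
    have "(1 / t) *\<^sub>R u \<in> psum_ball (\<bar>1 / t\<bar> * (N + N))" by (rule psum_ball_scale[OF u(1)])
    moreover have "\<bar>1 / t\<bar> * (N + N) = 4 * N / r * norm y"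
      using t r False by (simp add: t_def field_simps)
    moreover have "norm (y - (1 / t) *\<^sub>R u) < e"
    proof -
      have "y - (1 / t) *\<^sub>R u = (1 / t) *\<^sub>R (t *\<^sub>R y - u)"
        using t by (simp add: scaleR_right_diff_distrib)
      then have "norm (y - (1 / t) *\<^sub>R u) = norm (t *\<^sub>R y - u) / t"
        using t by simp
      also have "\<dots> < e" using u(2) t by (simp add: pos_divide_less_eq mult.commute)
      finally show ?thesis .
    qed
    ultimately show ?thesis by metis
  qed
  then show ?thesis using that[of "4 * N / r"] N r by simp
qed

text \<open>Completeness in the partial-sum norm. The Cauchy condition, uniform in \<open>n\<close>,
  makes every coefficient converge and allows the limits in \<open>p\<close> and \<open>n\<close> to
  be exchanged. The limit coefficients then expand \<open>y\<close>, and uniqueness identifies them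
  with \<open>A y\<close>.\<close>

lemma psum_closed_graph:
  assumes V: "\<And>p. V p \<in> Y" "V \<longlonglongrightarrow> y" and y: "y \<in> Y"
    and Cau: "\<And>e. e > 0 \<Longrightarrow> \<exists>m. \<forall>p\<ge>m. \<forall>n. norm (psum n (V p) - psum n (V m)) \<le> e"
  shows "(\<lambda>p. psum n (V p)) \<longlonglongrightarrow> psum n y"
proof -
  have "Cauchy (\<lambda>p. A (V p) k)" for k
  proof (rule CauchyI)
    fix e :: real assume "e > 0"
    \<comment> \<open>The \<open>k\<close>-th term is a difference of two partial sums, so its error
      is at most \<open>2 * d\<close>, which this choice keeps below
      \<open>e / 2 * norm (x k)\<close>.\<close>
    define d where "d = e * norm (x k) / 8"
    have "d > 0" using \<open>e > 0\<close> basis_nonzero by (simp add: d_def)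
    then obtain m where m: "\<And>p n. p \<ge> m \<Longrightarrow> norm (psum n (V p) - psum n (V m)) \<le> d" using Cau by blast
    have "norm (A (V p) k - A (V m) k) < e / 2" if "p \<ge> m" for p
    proof -
      have "\<bar>A (V p) k - A (V m) k\<bar> * norm (x k)
          = norm ((psum (Suc k) (V p) - psum (Suc k) (V m)) - (psum k (V p) - psum k (V m)))"
        by (simp flip: norm_scaleR add: scaleR_left_diff_distrib)
      also have "\<dots> \<le> d + d"
        by (intro norm_triangle_le_diff add_mono m that)
      also have "\<dots> < e / 2 * norm (x k)"
        using \<open>e > 0\<close> basis_nonzero by (simp add: d_def)
      finally show ?thesis using basis_nonzero[of k] by simp
    qed
    then have "norm (A (V p) k - A (V q) k) < e" if "p \<ge> m" "q \<ge> m" for p q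
      using \<open>\<And>p. p \<ge> m \<Longrightarrow> norm (A (V p) k - A (V m) k) < e / 2\<close>[OF that(1)]
        \<open>\<And>p. p \<ge> m \<Longrightarrow> norm (A (V p) k - A (V m) k) < e / 2\<close>[OF that(2)]
      unfolding real_norm_def by linarith
    then show "\<exists>M. \<forall>m\<ge>M. \<forall>n\<ge>M. norm (A (V m) k - A (V n) k) < e" by blast
  qed
  then obtain b where b: "\<And>k. (\<lambda>p. A (V p) k) \<longlonglongrightarrow> b k"
    unfolding Cauchy_convergent_iff convergent_def by metis
  let ?L = "\<lambda>n. \<Sum>k<n. b k *\<^sub>R x k"
  have L: "(\<lambda>p. psum n (V p)) \<longlonglongrightarrow> ?L n" for n
    by (intro tendsto_intros b)
  have "?L \<longlonglongrightarrow> y"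
  proof (rule LIMSEQ_I)
    fix e :: real assume e: "e > 0"
    then have "e / 4 > 0" by simp
    then obtain m0 where m0: "\<And>p n. p \<ge> m0 \<Longrightarrow> norm (psum n (V p) - psum n (V m0)) \<le> e / 4"
      using Cau by blast
    obtain m where m: "m \<ge> m0" "norm (V m - y) < e / 4"
      using LIMSEQ_D[OF V(2) \<open>e / 4 > 0\<close>] by (meson max.cobounded1 max.cobounded2)
    obtain n0 where n0: "\<And>n. n \<ge> n0 \<Longrightarrow> norm (psum n (V m) - V m) < e / 4"
      using LIMSEQ_D[OF psum_lim[OF V(1)] \<open>e / 4 > 0\<close>] by blast
    \<comment> \<open>The index \<open>m\<close> is fixed before \<open>n\<close>:
      \<open>?L n\<close> is uniformly close to \<open>psum n (V m)\<close>, which is close to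
      \<open>V m\<close> for large \<open>n\<close>, and \<open>V m\<close> is close to
      \<open>y\<close>.\<close>
    have L_close: "norm (?L n - psum n (V m)) \<le> e / 2" for n
    proof (rule tendsto_upperbound)
      show "(\<lambda>p. norm (psum n (V p) - psum n (V m))) \<longlonglongrightarrow> norm (?L n - psum n (V m))"
        by (intro tendsto_intros b)
      have "norm (psum n (V p) - psum n (V m)) \<le> e / 2" if "p \<ge> m0" for p
        using norm_triangle_ineq4[of "psum n (V p) - psum n (V m0)" "psum n (V m) - psum n (V m0)"]
          m0[OF that, of n] m0[OF m(1), of n] by simp
      then show "\<forall>\<^sub>F p in sequentially. norm (psum n (V p) - psum n (V m)) \<le> e / 2"
        unfolding eventually_sequentially by blast
    qed simp
    have "norm (?L n - y) < e" if "n \<ge> n0" for n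
    proof -
      have "norm (?L n - y) \<le> norm (?L n - psum n (V m)) + norm (psum n (V m) - y)"
        using norm_triangle_ineq[of "?L n - psum n (V m)" "psum n (V m) - y"] by simp
      also have "norm (psum n (V m) - y) \<le> norm (psum n (V m) - V m) + norm (V m - y)"
        using norm_triangle_ineq[of "psum n (V m) - V m" "V m - y"] by simp
      finally show ?thesis using n0[OF that] m(2) L_close[of n] by linarith
    qed
    then show "\<exists>no. \<forall>n\<ge>no. norm (?L n - y) < e" by blast
  qed
  then have "b = A y"
    using A_unique[OF y] unfolding sums_def by blast
  then show ?thesis using L by simp
qed

text \<open>Successive approximation: \<open>y\<close> is exhausted by corrections
  \<open>R i - R (Suc i)\<close> whose partial sums are at most \<open>M * norm y / 2 ^ i\<close>.
  The geometric series gives the constant \<open>2 * M\<close> for \<open>y - R p\<close>, and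
  \<open>psum_closed_graph\<close> carries it over to \<open>y\<close>.\<close>

lemma psum_bounded: "\<exists>C. \<forall>y\<in>Y. \<forall>n. norm (psum n y) \<le> C * norm y"
proof -
  obtain M where M: "M \<ge> 0"
    and dense: "\<And>y e. y \<in> Y \<Longrightarrow> e > 0 \<Longrightarrow> \<exists>u\<in>psum_ball (M * norm y). norm (y - u) < e"
    using psum_ball_dense by blast
  have "norm (psum n y) \<le> 2 * M * norm y" if y: "y \<in> Y" for y n
  proof (cases "y = 0")
    case True
    then show ?thesis using coeff_scale[OF y, of 0] by simp
  next
    case False
    have "\<exists>R. \<forall>i. (R i \<in> Y \<and> norm (R i) \<le> norm y / 2 ^ i \<and> (i = 0 \<longrightarrow> R i = y)) \<and>
        R i - R (Suc i) \<in> psum_ball (M * norm y / 2 ^ i)"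
    proof (rule dependent_nat_choice)
      show "\<exists>w. w \<in> Y \<and> norm w \<le> norm y / 2 ^ 0 \<and> (0 = (0::nat) \<longrightarrow> w = y)" using y by auto
      fix w i assume w: "w \<in> Y \<and> norm w \<le> norm y / 2 ^ i \<and> (i = 0 \<longrightarrow> w = y)"
      obtain u where u: "u \<in> psum_ball (M * norm w)" "norm (w - u) < norm y / 2 ^ Suc i"
        using dense[of w "norm y / 2 ^ Suc i"] w False by auto
      have "M * norm w \<le> M * norm y / 2 ^ i"
        using mult_left_mono[OF _ M, of "norm w" "norm y / 2 ^ i"] w by simp
      then have "u \<in> psum_ball (M * norm y / 2 ^ i)" using u(1) unfolding psum_ball_def by (auto intro: order_trans)
      moreover have "w - u \<in> Y" using u(1) w subspace_diff[OF Y(2)] by (simp add: psum_ball_def)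
      ultimately show "\<exists>z. (z \<in> Y \<and> norm z \<le> norm y / 2 ^ Suc i \<and> (Suc i = 0 \<longrightarrow> z = y)) \<and>
          w - z \<in> psum_ball (M * norm y / 2 ^ i)"
        using u(2) by (intro exI[of _ "w - u"]) auto
    qed
    then obtain R where "\<forall>i. (R i \<in> Y \<and> norm (R i) \<le> norm y / 2 ^ i \<and> (i = 0 \<longrightarrow> R i = y)) \<and>
        R i - R (Suc i) \<in> psum_ball (M * norm y / 2 ^ i)" by (rule exE)
    then have R: "\<And>i. R i \<in> Y" "\<And>i. norm (R i) \<le> norm y / 2 ^ i" "R 0 = y"
      "\<And>i. R i - R (Suc i) \<in> psum_ball (M * norm y / 2 ^ i)" by blast+
    \<comment> \<open>Keeping the subtracted last term of the geometric sum makes the induction on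
      \<open>j\<close> close exactly.\<close>
    have tail: "norm (psum n (R m) - psum n (R (m + j))) \<le> 2 * M * norm y / 2 ^ m - 2 * M * norm y / 2 ^ (m + j)"
      for n m j
    proof (induction j)
      case (Suc j)
      have "norm (psum n (R (m + j)) - psum n (R (Suc (m + j)))) \<le> M * norm y / 2 ^ (m + j)"
        using R(4)[of "m + j"] by (simp add: psum_ball_def psum_diff R(1))
      moreover have "2 * M * norm y / 2 ^ (m + j) = M * norm y / 2 ^ (m + j) + 2 * M * norm y / 2 ^ (m + Suc j)"
        by (simp add: field_simps)
      ultimately show ?case
        using Suc norm_triangle_ineq[of "psum n (R m) - psum n (R (m + j))" "psum n (R (m + j)) - psum n (R (Suc (m + j)))"]
        by simp
    qed simp
    have tail': "norm (psum n (R m) - psum n (R p)) \<le> 2 * M * norm y / 2 ^ m" if "p \<ge> m" for n m p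
    proof -
      have "0 \<le> 2 * M * norm y / 2 ^ p" using M by simp
      then show ?thesis using tail[where n = n and m = m and j = "p - m"] that by simp
    qed
    have lim2: "(\<lambda>i. c / 2 ^ i) \<longlonglongrightarrow> 0" for c :: real
      using tendsto_mult_right_zero[OF LIMSEQ_power_zero[of "1 / 2::real"], of c]
      by (simp add: power_divide)
    have "R \<longlonglongrightarrow> 0"
      by (rule Lim_null_comparison[OF _ lim2[of "norm y"]]) (simp add: R)
    have "(\<lambda>p. psum n (y - R p)) \<longlonglongrightarrow> psum n y"
    proof (rule psum_closed_graph)
      show "y - R p \<in> Y" for p using y R subspace_diff[OF Y(2)] by blast
      show "(\<lambda>p. y - R p) \<longlonglongrightarrow> y" using tendsto_diff[OF tendsto_const \<open>R \<longlonglongrightarrow> 0\<close>, of y] by simp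
      show "y \<in> Y" by fact
      fix e :: real assume "e > 0"
      then obtain m where "2 * M * norm y / 2 ^ m < e"
        using LIMSEQ_D[OF lim2[of "2 * M * norm y"], of e] M by auto
      then have "norm (psum n (y - R p) - psum n (y - R m)) \<le> e" if "p \<ge> m" for p n
        using tail'[OF that, where n = n] by (simp add: psum_diff y R)
      then show "\<exists>m. \<forall>p\<ge>m. \<forall>n. norm (psum n (y - R p) - psum n (y - R m)) \<le> e" by blast
    qed
    then have "(\<lambda>p. norm (psum n (y - R p))) \<longlonglongrightarrow> norm (psum n y)" by (rule tendsto_norm)
    moreover have "norm (psum n (y - R p)) \<le> 2 * M * norm y" for p
      using tail'[where m = 0 and p = p and n = n] by (simp add: psum_diff y R)
    ultimately show ?thesis
      by (intro tendsto_upperbound[OF _ _ sequentially_bot]) auto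
  qed
  then show ?thesis by blast
qed

end

text \<open>Coordinates defined only by uniqueness are continuous: \<open>psum_bounded\<close>
  applied to two consecutive partial sums bounds the \<open>j\<close>-th one by
  \<open>2 * C / norm (x j)\<close>, and \<open>Hahn_Banach_moment\<close> extends it to the whole
  space.\<close>

lemma schauder_basic_biorthogonal:
  fixes x :: "nat \<Rightarrow> 'a::banach"
  assumes "schauder_basic x"
  obtains \<phi> :: "nat \<Rightarrow> 'a \<Rightarrow>\<^sub>L real"
    where "\<And>j k. blinfun_apply (\<phi> j) (x k) = (if k = j then 1 else 0)"
proof -
  define Y where "Y = closure (span (range x))"
  have Y: "closed Y" "subspace Y" by (simp_all add: Y_def subspace_closure)
  define A where "A y = (THE a. (\<lambda>k. a k *\<^sub>R x k) sums y)" for y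
  have ex1: "\<exists>!a. (\<lambda>k. a k *\<^sub>R x k) sums y" if "y \<in> Y" for y
    using assms that unfolding schauder_basic_def Y_def by blast
  have A: "(\<lambda>k. A y k *\<^sub>R x k) sums y" if "y \<in> Y" for y
    unfolding A_def by (rule theI'[OF ex1[OF that]])
  have A_unique: "a = A y" if "y \<in> Y" "(\<lambda>k. a k *\<^sub>R x k) sums y" for y a
    unfolding A_def by (rule the1_equality[OF ex1[OF that(1)], symmetric]) (rule that(2))
  obtain C where C: "\<And>y n. y \<in> Y \<Longrightarrow> norm (\<Sum>k<n. A y k *\<^sub>R x k) \<le> C * norm y"
    using psum_bounded[OF Y A A_unique] by blast
  have nz: "x k \<noteq> 0" for k by (rule basis_nonzero[OF Y A A_unique])
  have "norm (x 0) \<le> C * norm (x 0)"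
  proof -
    have x0: "x 0 \<in> Y" unfolding Y_def by (intro subsetD[OF closure_subset] span_base rangeI)
    have "(\<lambda>k. (if k = 0 then 1 else 0) *\<^sub>R x k) sums x 0"
      using sums_single[of 0 x] by (simp add: if_distrib[of "\<lambda>t. t *\<^sub>R _"] cong: if_cong)
    then have "(\<lambda>k. if k = 0 then 1 else 0) = A (x 0)" by (rule A_unique[OF x0])
    then have "A (x 0) 0 = 1" by (auto dest: fun_cong[of _ _ 0])
    then show ?thesis using C[OF x0, of 1] by simp
  qed
  then have C0: "C \<ge> 0" using nz[of 0] by simp
  have "\<exists>f::'a \<Rightarrow>\<^sub>L real. \<forall>k. blinfun_apply f (x k) = (if k = j then 1 else 0)" for j
  proof (rule Hahn_Banach_moment)
    show "0 \<le> 2 * C / norm (x j)" using C0 by simp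
    fix a :: "nat \<Rightarrow> real" and n
    define y where "y = (\<Sum>k<n. a k *\<^sub>R x k)"
    have yY: "y \<in> Y"
      using closure_subset unfolding Y_def y_def by (rule subsetD) (intro span_sum span_scale span_base rangeI)
    have "(\<lambda>k. (if k < n then a k else 0) *\<^sub>R x k) sums y"
      unfolding y_def using sums_If_finite_set[of "{..<n}" "\<lambda>k. a k *\<^sub>R x k"]
      by (simp add: if_distrib[of "\<lambda>t. t *\<^sub>R _"] cong: if_cong)
    then have Ay: "A y = (\<lambda>k. if k < n then a k else 0)" by (rule A_unique[OF yY, symmetric])
    have "\<bar>A y j\<bar> * norm (x j) = norm ((\<Sum>k<Suc j. A y k *\<^sub>R x k) - (\<Sum>k<j. A y k *\<^sub>R x k))" by simp
    also have "\<dots> \<le> 2 * C * norm y"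
      using C[OF yY, of "Suc j"] C[OF yY, of j]
        norm_triangle_ineq4[of "\<Sum>k<Suc j. A y k *\<^sub>R x k" "\<Sum>k<j. A y k *\<^sub>R x k"] by linarith
    finally have "\<bar>A y j\<bar> \<le> 2 * C * norm y / norm (x j)"
      using nz by (simp add: field_simps)
    moreover have "(\<Sum>k<n. a k * (if k = j then 1 else 0)) = A y j"
      by (simp add: Ay if_distrib cong: if_cong)
    ultimately show "(\<Sum>k<n. a k * (if k = j then 1 else 0)) \<le> 2 * C / norm (x j) * norm (\<Sum>k<n. a k *\<^sub>R x k)"
      by (simp add: y_def)
  qed blast
  then show ?thesis
    using that choice[of "\<lambda>j f. \<forall>k. blinfun_apply f (x k) = (if k = j then 1 else 0)"] by blast
qed

subsection \<open>Finite-dimensional subspaces and weak-star cluster points\<close>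

text \<open>Induction on the generators. A vector \<open>b\<close> outside \<open>span B\<close> has
  positive distance \<open>d\<close> from it, so in \<open>w = t *\<^sub>R b + v\<close> with
  \<open>norm w \<le> r\<close> both \<open>t\<close> and \<open>v\<close> stay bounded. The ball is
  thus a closed part of a continuous image of a compact product.\<close>

lemma compact_span_cball:
  fixes B :: "'a::real_normed_vector set"
  assumes "finite B"
  shows "compact (span B \<inter> cball 0 r)"
  using assms
proof (induction B arbitrary: r)
  case empty
  have "span {} \<inter> cball 0 r \<subseteq> {0::'a}" by auto
  then have "finite (span {} \<inter> cball (0::'a) r)" by (rule finite_subset) simp
  then show ?case by (rule finite_imp_compact)
next
  case (insert b B)
  show ?case
  proof (cases "b \<in> span B")
    case True
    then show ?thesis using insert.IH by (simp add: span_redundant)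
  next
    case False
    \<comment> \<open>A convergent sequence is bounded, hence stays in one of the compact balls of
      the induction hypothesis.\<close>
    have "closed (span B)"
      unfolding closed_sequential_limits
    proof (intro allI impI, elim conjE)
      fix u l assume u: "\<forall>n. u n \<in> span B" "u \<longlonglongrightarrow> l"
      obtain R where "\<And>n. norm (u n) \<le> R"
        using convergent_imp_Bseq[OF convergentI[OF u(2)]] unfolding Bseq_def by blast
      then have "\<forall>n. u n \<in> span B \<inter> cball 0 R" using u(1) by simp
      then have "l \<in> span B \<inter> cball 0 R"
        using closed_sequentially[OF compact_imp_closed[OF insert.IH[of R]] _ u(2)] by simp
      then show "l \<in> span B" by blast
    qed
    moreover have "span B \<noteq> {}" using span_zero by blast
    ultimately have "infdist b (span B) \<noteq> 0" using False in_closed_iff_infdist_zero by blast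
    then obtain d where d: "d > 0" "\<And>v. v \<in> span B \<Longrightarrow> d \<le> dist b v"
      using that[of "infdist b (span B)"] infdist_nonneg[of b "span B"] infdist_le by force
    let ?K = "(\<lambda>p. fst p *\<^sub>R b + snd p) ` ({- (r / d)..r / d} \<times> (span B \<inter> cball 0 (r + r / d * norm b)))"
    have "compact ?K"
      by (intro compact_continuous_image compact_Times insert.IH compact_Icc continuous_intros)
    moreover have "span (insert b B) \<inter> cball 0 r = ?K \<inter> cball 0 r"
    proof (intro equalityI subsetI)
      fix w assume w: "w \<in> span (insert b B) \<inter> cball 0 r"
      then obtain t where t: "w - t *\<^sub>R b \<in> span B" unfolding span_insert by blast
      have wr: "norm w \<le> r" using w by simp
      have "\<bar>t\<bar> * d \<le> norm w"
      proof (cases "t = 0")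
        case False
        have "d \<le> dist b ((- (1 / t)) *\<^sub>R (w - t *\<^sub>R b))" by (intro d(2) span_scale t)
        also have "\<dots> = norm ((1 / t) *\<^sub>R w)"
          using False by (simp add: dist_norm scaleR_right_diff_distrib)
        finally show ?thesis using False by (simp add: field_simps)
      qed simp
      then have tr: "\<bar>t\<bar> \<le> r / d" using wr d(1) by (simp add: field_simps)
      have "norm (w - t *\<^sub>R b) \<le> norm w + \<bar>t\<bar> * norm b"
        using norm_triangle_ineq4[of w "t *\<^sub>R b"] by simp
      also have "\<dots> \<le> r + r / d * norm b"
        using wr tr by (intro add_mono mult_right_mono) auto
      finally have "(t, w - t *\<^sub>R b) \<in> {- (r / d)..r / d} \<times> (span B \<inter> cball 0 (r + r / d * norm b))"
        using t tr by (simp add: abs_le_iff)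
      from imageI[OF this, of "\<lambda>p. fst p *\<^sub>R b + snd p"] show "w \<in> ?K \<inter> cball 0 r"
        using wr by simp
    next
      fix w assume w: "w \<in> ?K \<inter> cball 0 r"
      then obtain t v where "w = t *\<^sub>R b + v" "v \<in> span B" by auto
      then have "w \<in> span (insert b B)"
        using span_mono[of B "insert b B"] by (auto intro: span_add span_scale span_base)
      then show "w \<in> span (insert b B) \<inter> cball 0 r" using w by simp
    qed
    ultimately show ?thesis by (simp add: compact_Int_closed)
  qed
qed

lemma compact_span_sphere:
  fixes B :: "'a::real_normed_vector set"
  assumes "finite B"
  shows "compact (span B \<inter> sphere 0 r)"
proof -
  have "closed {w::'a. norm w = r}" by (intro closed_Collect_eq continuous_intros)
  with compact_span_cball[OF assms, of r] have "compact ((span B \<inter> cball 0 r) \<inter> {w. norm w = r})"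
    by (rule compact_Int_closed)
  moreover have "(span B \<inter> cball 0 r) \<inter> {w. norm w = r} = span B \<inter> sphere 0 r" by auto
  ultimately show ?thesis by simp
qed

text \<open>By compactness the unit sphere of \<open>span B\<close> has distance at least some
  \<open>d > 0\<close> from \<open>S\<close>, so \<open>d * norm z \<le> norm (u + z)\<close>; the
  triangle inequality converts this into a bound for \<open>u\<close> with constant
  \<open>d / (1 + d)\<close>.\<close>

lemma finite_dim_complement_bound:
  fixes S :: "'a::real_normed_vector set"
  assumes S: "closed S" "subspace S" and B: "finite B" and disj: "S \<inter> span B = {0}"
  obtains c where "c > 0" "\<And>u z. u \<in> S \<Longrightarrow> z \<in> span B \<Longrightarrow> c * norm u \<le> norm (u + z)"
proof -
  let ?K = "span B \<inter> sphere 0 1"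
  have "\<exists>d>0. \<forall>z\<in>?K. d \<le> infdist z S"
  proof (cases "?K = {}")
    case False
    have "continuous_on ?K (\<lambda>z. infdist z S)" by (intro continuous_intros)
    from continuous_attains_inf[OF compact_span_sphere[OF B] False this]
    obtain z0 where z0: "z0 \<in> ?K" "\<forall>z\<in>?K. infdist z0 S \<le> infdist z S" by blast
    have "z0 \<notin> S"
    proof
      assume "z0 \<in> S"
      then have "z0 = 0" using disj z0(1) by blast
      then show False using z0(1) by simp
    qed
    moreover have "S \<noteq> {}" using subspace_0[OF S(2)] by blast
    ultimately have "infdist z0 S \<noteq> 0" using in_closed_iff_infdist_zero[OF S(1)] by blast
    then have "infdist z0 S > 0" using infdist_nonneg[of z0 S] by simp
    then show ?thesis using z0(2) by blast
  next
    \<comment> \<open>For trivial \<open>span B\<close> the sphere is empty and any positive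
      \<open>d\<close> serves.\<close>
    case True
    show ?thesis unfolding True by (rule exI[of _ 1]) simp
  qed
  then obtain d where d: "d > 0" "\<forall>z\<in>?K. d \<le> infdist z S" by blast
  have d_le: "d \<le> dist z u" if "z \<in> ?K" "u \<in> S" for z u
  proof -
    have "d \<le> infdist z S" using d(2) that(1) by (rule bspec)
    also have "\<dots> \<le> dist z u" by (rule infdist_le[OF that(2)])
    finally show ?thesis .
  qed
  have key: "d * norm z \<le> norm (u + z)" if "u \<in> S" "z \<in> span B" for u z
  proof (cases "z = 0")
    case False
    have "d \<le> dist ((1 / norm z) *\<^sub>R z) ((- (1 / norm z)) *\<^sub>R u)"
      using that False by (intro d_le subspace_scale[OF S(2)]) (simp_all add: span_scale)
    also have "\<dots> = norm ((1 / norm z) *\<^sub>R (u + z))"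
      by (simp add: dist_norm scaleR_add_right add.commute)
    also have "\<dots> = norm (u + z) / norm z" unfolding norm_scaleR by simp
    finally show ?thesis using False by (simp add: pos_le_divide_eq)
  qed simp
  show ?thesis
  proof
    show "d / (1 + d) > 0" using d(1) by simp
    fix u z assume uz: "u \<in> S" "z \<in> span B"
    have "norm u \<le> norm (u + z) + norm z" using norm_triangle_ineq4[of "u + z" z] by simp
    then have "d * norm u \<le> d * norm (u + z) + d * norm z"
      using d(1) mult_left_mono[of "norm u" "norm (u + z) + norm z" d] by (simp add: distrib_left)
    then have "d * norm u \<le> norm (u + z) * (1 + d)" using key[OF uz] by (simp add: algebra_simps)
    then show "d / (1 + d) * norm u \<le> norm (u + z)" using d(1) by (simp add: field_simps)
  qed
qed

text \<open>Take a finite \<open>1 / 4\<close>-net of the unit sphere. The norm of a functional is a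
  supremum that may not be attained, so each net point is normed only up to \<open>1 / 2\<close>;
  passing to a nearby unit vector loses another \<open>1 / 4\<close>.\<close>

lemma finite_dim_norming_set:
  fixes B :: "('a::real_normed_vector \<Rightarrow>\<^sub>L real) set"
  assumes "finite B"
  obtains \<Phi> where "finite \<Phi>" "\<And>f. f \<in> \<Phi> \<Longrightarrow> norm f \<le> 1"
    "\<And>w. w \<in> span B \<Longrightarrow> \<exists>f\<in>\<Phi>. norm w / 4 \<le> blinfun_apply w f"
proof -
  have "\<forall>e>0. \<exists>C. finite C \<and> C \<subseteq> span B \<inter> sphere 0 1 \<and> span B \<inter> sphere 0 1 \<subseteq> (\<Union>w\<in>C. ball w e)"
    by (intro seq_compact_imp_totally_bounded compact_imp_seq_compact compact_span_sphere assms)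
  from this[rule_format, of "1 / 4"] obtain C where C: "finite C" "C \<subseteq> span B \<inter> sphere 0 1"
      "span B \<inter> sphere 0 1 \<subseteq> (\<Union>w\<in>C. ball w (1 / 4))"
    by auto
  have "\<exists>f. norm f \<le> 1 \<and> 1 / 2 \<le> blinfun_apply w f" if "w \<in> C" for w
  proof (rule ccontr)
    assume "\<not> ?thesis"
    then have small: "blinfun_apply w f < 1 / 2" if "norm f \<le> 1" for f
      using that by (meson not_le)
    have "norm w \<le> 1 / 2"
    proof (rule norm_blinfun_bound)
      fix f
      show "norm (blinfun_apply w f) \<le> 1 / 2 * norm f"
      proof (cases "f = 0")
        case False
        have "\<bar>blinfun_apply w ((1 / norm f) *\<^sub>R f)\<bar> < 1 / 2"
          using small[of "(1 / norm f) *\<^sub>R f"] small[of "- ((1 / norm f) *\<^sub>R f)"] False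
          by (simp add: blinfun.minus_right)
        then show ?thesis using False by (simp add: blinfun.scaleR_right field_simps)
      qed simp
    qed simp
    moreover have "norm w = 1" using C(2) \<open>w \<in> C\<close> by auto
    ultimately show False by simp
  qed
  then have "\<forall>w\<in>C. \<exists>f. norm f \<le> 1 \<and> 1 / 2 \<le> blinfun_apply w f" by blast
  from bchoice[OF this] obtain F
    where F: "\<And>w. w \<in> C \<Longrightarrow> norm (F w) \<le> 1" "\<And>w. w \<in> C \<Longrightarrow> 1 / 2 \<le> blinfun_apply w (F w)"
    by blast
  show ?thesis
  proof
    \<comment> \<open>The added \<open>0\<close> serves \<open>w = 0\<close>, for which the net may
      be empty.\<close>
    show "finite (insert 0 (F ` C))" using C(1) by simp
    show "norm f \<le> 1" if "f \<in> insert 0 (F ` C)" for f using that F(1) by auto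
    fix w assume w: "w \<in> span B"
    show "\<exists>f\<in>insert 0 (F ` C). norm w / 4 \<le> blinfun_apply w f"
    proof (cases "w = 0")
      case False
      define v where "v = (1 / norm w) *\<^sub>R w"
      have "v \<in> span B \<inter> sphere 0 1" using w False by (simp add: v_def span_scale)
      then obtain w0 where w0: "w0 \<in> C" "norm (w0 - v) < 1 / 4"
        using subsetD[OF C(3)] unfolding dist_norm[symmetric] by (metis UN_E mem_ball)
      have "blinfun_apply w0 (F w0) - blinfun_apply v (F w0) \<le> norm (w0 - v) * norm (F w0)"
        using norm_blinfun[of "w0 - v" "F w0"] by (simp add: blinfun.diff_left)
      also have "\<dots> \<le> norm (w0 - v)" using F(1)[OF w0(1)] by (simp add: mult_left_le)
      finally have "1 / 4 \<le> blinfun_apply v (F w0)" using F(2)[OF w0(1)] w0(2) by linarith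
      also have "blinfun_apply v (F w0) = blinfun_apply w (F w0) / norm w"
        by (simp add: v_def blinfun.scaleR_left)
      finally have "norm w / 4 \<le> blinfun_apply w (F w0)"
        using False by (simp add: pos_le_divide_eq)
      then show ?thesis using w0(1) by blast
    next
      case True
      show ?thesis unfolding True by (rule bexI[of _ 0]) simp_all
    qed
  qed
qed

text \<open>A finite set of functionals with a tolerance describes a basic weak-star neighbourhood.
  Cluster points replace limits because a sequence equivalent to the \<open>l1\<close> basis has no
  weak-Cauchy subsequence.\<close>

definition wstar_cluster :: "(nat \<Rightarrow> 'a::real_normed_vector) \<Rightarrow> ('a \<Rightarrow>\<^sub>L real) \<Rightarrow>\<^sub>L real \<Rightarrow> bool" where
  "wstar_cluster x z \<longleftrightarrow> (\<forall>\<Phi> e N. finite \<Phi> \<longrightarrow> e > 0 \<longrightarrow>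
     (\<exists>n\<ge>N. \<forall>f\<in>\<Phi>. \<bar>blinfun_apply f (x n) - blinfun_apply z f\<bar> < e))"

lemma wstar_clusterD:
  assumes "wstar_cluster x z" "finite \<Phi>" "e > 0"
  obtains n where "n \<ge> N" "\<forall>f\<in>\<Phi>. \<bar>blinfun_apply f (x n) - blinfun_apply z f\<bar> < e"
  using assms unfolding wstar_cluster_def by meson

lemma wstar_lim_imp_cluster:
  assumes "wstar_lim x z"
  shows "wstar_cluster x z"
  unfolding wstar_cluster_def
proof (intro allI impI)
  fix \<Phi> :: "('a \<Rightarrow>\<^sub>L real) set" and e :: real and N
  assume "finite \<Phi>" "e > 0"
  have "\<forall>\<^sub>F n in sequentially. \<bar>blinfun_apply f (x n) - blinfun_apply z f\<bar> < e" for f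
    using assms \<open>e > 0\<close> unfolding wstar_lim_def canon_apply tendsto_iff dist_real_def by blast
  then have "\<forall>\<^sub>F n in sequentially. \<forall>f\<in>\<Phi>. \<bar>blinfun_apply f (x n) - blinfun_apply z f\<bar> < e"
    using \<open>finite \<Phi>\<close> by (simp add: eventually_ball_finite)
  then have "\<forall>\<^sub>F n in sequentially. n \<ge> N \<and> (\<forall>f\<in>\<Phi>. \<bar>blinfun_apply f (x n) - blinfun_apply z f\<bar> < e)"
    by (intro eventually_conj eventually_ge_at_top)
  then show "\<exists>n\<ge>N. \<forall>f\<in>\<Phi>. \<bar>blinfun_apply f (x n) - blinfun_apply z f\<bar> < e"
    using eventually_happens' sequentially_bot by blast
qed

lemma weakly_null_iff_wstar_lim: "weakly_null x \<longleftrightarrow> wstar_lim x 0"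
  unfolding weakly_null_def wstar_lim_def by simp

lemma wstar_cluster_subseq:
  assumes "wstar_cluster (x \<circ> r) z" "strict_mono r"
  shows "wstar_cluster x z"
  unfolding wstar_cluster_def
proof (intro allI impI)
  fix \<Phi> :: "('a \<Rightarrow>\<^sub>L real) set" and e :: real and N
  assume "finite \<Phi>" "e > 0"
  then obtain n where "n \<ge> N" "\<forall>f\<in>\<Phi>. \<bar>blinfun_apply f ((x \<circ> r) n) - blinfun_apply z f\<bar> < e"
    using wstar_clusterD[OF assms(1)] by blast
  then show "\<exists>n\<ge>N. \<forall>f\<in>\<Phi>. \<bar>blinfun_apply f (x n) - blinfun_apply z f\<bar> < e"
    using seq_suble[OF assms(2), of n] by (intro exI[of _ "r n"]) auto
qed

text \<open>Tychonoff yields a pointwise cluster point of the evaluations; any approximate identity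
  between finitely many values passes to it, which makes it linear.\<close>

lemma wstar_cluster_exists:
  fixes x :: "nat \<Rightarrow> 'a::real_normed_vector"
  assumes bd: "\<And>n. norm (x n) \<le> C"
  shows "\<exists>z. wstar_cluster x z"
proof -
  define h where "h n = (\<lambda>f::'a \<Rightarrow>\<^sub>L real. blinfun_apply f (x n))" for n
  \<comment> \<open>A product of intervals, one for each functional, large enough to contain the
    evaluations at all \<open>x n\<close>.\<close>
  define K where "K = Pi\<^sub>E UNIV (\<lambda>f::'a \<Rightarrow>\<^sub>L real. cball (0::real) (norm f * C))"
  have "compactin (product_topology (\<lambda>_. euclidean) UNIV) K"
    unfolding K_def compactin_PiE by (simp add: compactin_euclidean_iff)
  then have "compact K" by (simp add: euclidean_product_topology compactin_euclidean_iff)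
  moreover have hK: "h n \<in> K" for n
  proof -
    have "\<bar>blinfun_apply f (x n)\<bar> \<le> norm f * C" for f :: "'a \<Rightarrow>\<^sub>L real"
      using norm_blinfun[of f "x n"] mult_left_mono[OF bd norm_ge_zero[of f], of n] by simp
    then show ?thesis by (simp add: K_def h_def PiE_iff)
  qed
  then have "eventually (\<lambda>g. g \<in> K) (filtermap h sequentially)"
    by (simp add: eventually_filtermap)
  moreover have "filtermap h sequentially \<noteq> bot" by (simp add: filtermap_bot_iff)
  \<comment> \<open>Compactness in filter form: the image of the sequence under evaluation is
    eventually in \<open>K\<close>, so it clusters at some \<open>z0\<close>.\<close>
  ultimately obtain z0 where z0: "z0 \<in> K" "inf (nhds z0) (filtermap h sequentially) \<noteq> bot"
    unfolding compact_filter by blast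
  have cl: "\<exists>n\<ge>N. \<forall>f\<in>\<Phi>. \<bar>h n f - z0 f\<bar> < e" if "finite \<Phi>" "e > 0" for \<Phi> e N
  proof (rule ccontr)
    assume no: "\<not> ?thesis"
    let ?U = "{g. \<forall>f\<in>\<Phi>. g f \<in> ball (z0 f) e}"
    have "open ?U" using product_topology_basis'[of \<Phi> "\<lambda>f. ball (z0 f) e" "\<lambda>f. f"] that by simp
    then have "eventually (\<lambda>g. g \<in> ?U) (nhds z0)"
      using that(2) by (intro eventually_nhds_in_open) auto
    moreover have "eventually (\<lambda>g. g \<notin> ?U) (filtermap h sequentially)"
      unfolding eventually_filtermap eventually_sequentially
      using no by (auto simp: dist_real_def abs_minus_commute)
    ultimately have "eventually (\<lambda>g. False) (inf (nhds z0) (filtermap h sequentially))"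
      unfolding eventually_inf by blast
    then show False using z0(2) by (simp add: trivial_limit_def)
  qed
  have "bounded_linear z0"
  proof (rule bounded_linear_intro)
    fix f g :: "'a \<Rightarrow>\<^sub>L real"
    have *: "\<bar>z0 (f + g) - (z0 f + z0 g)\<bar> \<le> 0 + e" if "e > 0" for e
    proof -
      from that have "e / 3 > 0" by simp
      from cl[OF _ this, of "{f, g, f + g}"] obtain n where
        n: "\<bar>h n f - z0 f\<bar> < e / 3" "\<bar>h n g - z0 g\<bar> < e / 3" "\<bar>h n (f + g) - z0 (f + g)\<bar> < e / 3"
        by auto
      have "h n (f + g) = h n f + h n g" by (simp add: h_def blinfun.add_left)
      with n show ?thesis unfolding abs_le_iff abs_less_iff by linarith
    qed
    from field_le_epsilon[OF *] show "z0 (f + g) = z0 f + z0 g" by simp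
  next
    fix c :: real and f :: "'a \<Rightarrow>\<^sub>L real"
    have *: "\<bar>z0 (c *\<^sub>R f) - c * z0 f\<bar> \<le> 0 + e" if "e > 0" for e
    proof -
      define d where "d = e / (1 + \<bar>c\<bar>)"
      have d: "d > 0" "d * (1 + \<bar>c\<bar>) = e" using \<open>e > 0\<close> by (simp_all add: d_def)
      from cl[OF _ d(1), of "{f, c *\<^sub>R f}"] obtain n where
        n: "\<bar>h n f - z0 f\<bar> < d" "\<bar>h n (c *\<^sub>R f) - z0 (c *\<^sub>R f)\<bar> < d" by auto
      have "h n (c *\<^sub>R f) = c * h n f" by (simp add: h_def blinfun.scaleR_left)
      then have "z0 (c *\<^sub>R f) - c * z0 f = c * (h n f - z0 f) - (h n (c *\<^sub>R f) - z0 (c *\<^sub>R f))"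
        by (simp add: right_diff_distrib)
      then have "\<bar>z0 (c *\<^sub>R f) - c * z0 f\<bar> \<le> \<bar>h n (c *\<^sub>R f) - z0 (c *\<^sub>R f)\<bar> + \<bar>c * (h n f - z0 f)\<bar>"
        using abs_triangle_ineq4[of "c * (h n f - z0 f)" "h n (c *\<^sub>R f) - z0 (c *\<^sub>R f)"] by simp
      also have "\<dots> \<le> d + \<bar>c\<bar> * d"
        unfolding abs_mult using n by (intro add_mono mult_left_mono) auto
      finally show ?thesis using d(2) by (simp add: algebra_simps)
    qed
    from field_le_epsilon[OF *] show "z0 (c *\<^sub>R f) = c *\<^sub>R z0 f" by simp
  next
    fix f :: "'a \<Rightarrow>\<^sub>L real"
    show "norm (z0 f) \<le> norm f * C" using z0(1) by (auto simp: K_def PiE_iff)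
  qed
  then have "blinfun_apply (Blinfun z0) = z0" by (rule bounded_linear_Blinfun_apply)
  then have "wstar_cluster x (Blinfun z0)" using cl unfolding wstar_cluster_def h_def by simp
  then show ?thesis by blast
qed

text \<open>The relation is for an indexed family, which may repeat vectors. Without repetition,
  \<open>card B + 1\<close> vectors in \<open>span B\<close> form a dependent set; a repetition
  \<open>w p = w q\<close> gives a relation with coefficients \<open>1\<close> and
  \<open>- 1\<close>.\<close>

lemma linear_dependence_family:
  fixes w :: "nat \<Rightarrow> 'a::real_vector"
  assumes B: "finite B" and w: "\<And>p. p \<le> card B \<Longrightarrow> w p \<in> span B"
  obtains c where "\<exists>p\<le>card B. c p \<noteq> 0" "(\<Sum>p\<le>card B. c p *\<^sub>R w p) = 0"
proof (cases "inj_on w {..card B}")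
  case True
  then have "card (w ` {..card B}) = Suc (card B)" by (simp add: card_image)
  then have "\<not> independent (w ` {..card B})"
    using independent_span_bound[OF B, of "w ` {..card B}"] w by auto
  then obtain u where u: "\<exists>v\<in>w ` {..card B}. u v \<noteq> 0" "(\<Sum>v\<in>w ` {..card B}. u v *\<^sub>R v) = 0"
    using dependent_finite[of "w ` {..card B}"] by auto
  show ?thesis
  proof (rule that)
    show "\<exists>p\<le>card B. u (w p) \<noteq> 0" using u(1) by auto
    show "(\<Sum>p\<le>card B. u (w p) *\<^sub>R w p) = 0" using u(2) by (simp add: sum.reindex[OF True])
  qed
next
  case False
  then obtain p q where pq: "p \<le> card B" "q \<le> card B" "w p = w q" "p \<noteq> q"
    unfolding inj_on_def by auto
  let ?c = "\<lambda>r. (if r = p then 1 else 0) - (if r = q then 1 else 0) :: real"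
  show ?thesis
  proof (rule that)
    show "\<exists>r\<le>card B. ?c r \<noteq> 0" using pq by (intro exI[of _ p]) auto
    show "(\<Sum>r\<le>card B. ?c r *\<^sub>R w r) = 0"
      using pq by (simp add: scaleR_left_diff_distrib sum_subtractf if_distrib[of "\<lambda>t. t *\<^sub>R _"] cong: if_cong)
  qed
qed

lemma wstar_cluster_eq:
  assumes z: "wstar_cluster x z" and t: "\<And>n. n \<ge> N \<Longrightarrow> blinfun_apply f (x n) = t"
  shows "blinfun_apply z f = t"
proof (rule ccontr)
  assume "blinfun_apply z f \<noteq> t"
  then have "\<bar>t - blinfun_apply z f\<bar> > 0" by simp
  from wstar_clusterD[OF z _ this, of "{f}" N] obtain n where
    "n \<ge> N" "\<bar>blinfun_apply f (x n) - blinfun_apply z f\<bar> < \<bar>t - blinfun_apply z f\<bar>"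
    by auto
  then show False using t by simp
qed

text \<open>A common vector with nonzero \<open>z\<close>-coefficient could be solved for
  \<open>z\<close>, contradicting the choice of \<open>z\<close>; with zero coefficient it lies in
  the old intersection.\<close>

lemma range_canon_inter_span_insert:
  assumes disj: "range canon \<inter> span B = {0}"
    and z: "\<forall>u. \<forall>w\<in>span B. z \<noteq> canon u + w"
  shows "range canon \<inter> span (insert z B) = {0}"
proof -
  have "q = 0" if "q \<in> range canon" "q \<in> span (insert z B)" for q
  proof -
    obtain k where k: "q - k *\<^sub>R z \<in> span B" using \<open>q \<in> span (insert z B)\<close> unfolding span_insert by blast
    obtain u where u: "q = canon u" using \<open>q \<in> range canon\<close> by blast
    show ?thesis
    proof (cases "k = 0")
      case True
      then show ?thesis using k that(1) disj by auto
    next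
      case False
      have "canon ((1 / k) *\<^sub>R u) = (1 / k) *\<^sub>R q" by (simp add: u linear_scale[OF linear_canon])
      then have "z = canon ((1 / k) *\<^sub>R u) + (- (1 / k)) *\<^sub>R (q - k *\<^sub>R z)"
        using False by (simp add: scaleR_right_diff_distrib)
      then show ?thesis using z span_scale[OF k] by blast
    qed
  qed
  moreover have "0 \<in> range canon"
    using linear_0[OF linear_canon] by (metis rangeI)
  ultimately show ?thesis using span_zero by blast
qed

text \<open>An \<open>\<ell>\<^sub>1\<close>-sequence has infinitely many cluster points independent modulo \<open>X\<close>: cluster points
  along disjoint subsequences are told apart by functionals with prescribed signs on each
  subsequence that vanish on any given finite part, hence almost vanish on any given vector of \<open>X\<close>.\<close>

lemma l1_equiv_cluster_outside:
  fixes B :: "(('a::banach \<Rightarrow>\<^sub>L real) \<Rightarrow>\<^sub>L real) set"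
  assumes B: "finite B" and l1: "l1_equiv x"
  obtains z where "wstar_cluster x z" "\<forall>u. \<forall>w\<in>span B. z \<noteq> canon u + w"
proof -
  obtain c C where c: "c > 0"
    and lo: "\<And>a n. c * (\<Sum>k<n. \<bar>a k\<bar>) \<le> norm (\<Sum>k<n. a k *\<^sub>R x k)"
    and up: "\<And>a n. norm (\<Sum>k<n. a k *\<^sub>R x k) \<le> C * (\<Sum>k<n. \<bar>a k\<bar>)"
    using l1 unfolding l1_equiv_def by blast
  have bd: "norm (x k) \<le> C" for k
    using up[where a = "\<lambda>j. if j = k then 1 else 0" and n = "Suc k"]
    by (simp add: if_distrib[of "\<lambda>t. t *\<^sub>R _"] if_distrib[of abs] cong: if_cong)
  define d where "d = card B"
  \<comment> \<open>Residue classes modulo \<open>card B + 1\<close> give disjoint subsequences, one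
    more than there are generators of \<open>span B\<close>.\<close>
  define r where "r p n = n * Suc d + p" for p n
  have r_mono: "strict_mono (r p)" for p
    unfolding r_def by (intro strict_monoI add_strict_right_mono mult_less_mono1) auto
  have "\<forall>p. \<exists>z. wstar_cluster (x \<circ> r p) z"
    by (intro allI wstar_cluster_exists[where C = C]) (simp add: bd)
  from choice[OF this] obtain Z where Z: "\<And>p. wstar_cluster (x \<circ> r p) (Z p)" by blast
  have "\<exists>p\<le>d. \<forall>u. \<forall>w\<in>span B. Z p \<noteq> canon u + w"
  proof (rule ccontr)
    assume "\<not> ?thesis"
    then have "\<forall>p. \<exists>q. p \<le> d \<longrightarrow> snd q \<in> span B \<and> Z p = canon (fst q) + snd q"
      by (metis fst_conv snd_conv)
    from choice[OF this] obtain q where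
      q: "\<And>p. p \<le> d \<Longrightarrow> snd (q p) \<in> span B" "\<And>p. p \<le> d \<Longrightarrow> Z p = canon (fst (q p)) + snd (q p)"
      by blast
    \<comment> \<open>This relation cancels the \<open>span B\<close> components, so the same
      combination of the cluster points lies in the canonical image.\<close>
    obtain b where b: "\<exists>p\<le>d. b p \<noteq> 0" "(\<Sum>p\<le>d. b p *\<^sub>R snd (q p)) = 0"
      using linear_dependence_family[OF B, of "\<lambda>p. snd (q p)"] q(1) unfolding d_def by blast
    define v where "v = (\<Sum>p\<le>d. b p *\<^sub>R fst (q p))"
    have "(\<Sum>p\<le>d. b p *\<^sub>R Z p) = (\<Sum>p\<le>d. b p *\<^sub>R canon (fst (q p))) + (\<Sum>p\<le>d. b p *\<^sub>R snd (q p))"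
      unfolding sum.distrib[symmetric] by (intro sum.cong) (simp_all add: q(2) scaleR_add_right)
    also have "\<dots> = canon v"
      by (simp add: b(2) v_def linear_sum[OF linear_canon] linear_scale[OF linear_canon])
    finally have "blinfun_apply (\<Sum>p\<le>d. b p *\<^sub>R Z p) f = blinfun_apply (canon v) f" for f by simp
    then have Zv: "(\<Sum>p\<le>d. b p * blinfun_apply (Z p) f) = blinfun_apply f v" for f
      by (simp add: blinfun.sum_left blinfun.scaleR_left)
    define \<sigma> where "\<sigma> = (\<Sum>p\<le>d. \<bar>b p\<bar>)"
    have \<sigma>: "\<sigma> > 0"
    proof -
      obtain p where "p \<le> d" "b p \<noteq> 0" using b(1) by blast
      then show ?thesis unfolding \<sigma>_def by (intro sum_pos2[of _ p]) auto
    qed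
    \<comment> \<open>A functional that vanishes on the sequence vanishes at all its cluster points,
      hence at \<open>v\<close>.\<close>
    have "v \<in> closure (span (range x))"
    proof (rule ccontr)
      assume "v \<notin> closure (span (range x))"
      then obtain f :: "'a \<Rightarrow>\<^sub>L real"
        where f: "\<And>y. y \<in> span (range x) \<Longrightarrow> blinfun_apply f y = 0" "blinfun_apply f v = 1"
        using Hahn_Banach_separation[OF subspace_span] by blast
      have "blinfun_apply (Z p) f = 0" for p
        by (rule wstar_cluster_eq[OF Z, of 0]) (simp add: f(1) span_base)
      then show False using Zv[of f] f(2) by simp
    qed
    moreover have "\<sigma> * c > 0" using \<sigma> c by simp
    ultimately obtain y where y: "y \<in> span (range x)" "norm (y - v) < \<sigma> * c"
      unfolding closure_approachable dist_norm by blast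
    obtain a N where a: "y = (\<Sum>k<N. a k *\<^sub>R x k)" using y(1) unfolding span_range_nat by blast
    \<comment> \<open>Zero on the support of \<open>y\<close>, and the sign of \<open>b p\<close> on
      later members of class \<open>p\<close>. The functional with these values has norm at most
      \<open>1 / c\<close> and value \<open>\<sigma>\<close> at \<open>v - y\<close>, although
      \<open>norm (y - v) < \<sigma> * c\<close>.\<close>
    define g where "g k = (if k < N then 0 else sgn (b (k mod Suc d)))" for k
    have g: "\<bar>g k\<bar> \<le> 1" for k by (simp add: g_def abs_sgn_eq)
    have "(\<Sum>k<n. a k * g k) \<le> 1 / c * norm (\<Sum>k<n. a k *\<^sub>R x k)" for a n
    proof -
      have "(\<Sum>k<n. a k * g k) \<le> (\<Sum>k<n. \<bar>a k\<bar>)"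
      proof (intro sum_mono)
        fix k
        have "a k * g k \<le> \<bar>a k\<bar> * \<bar>g k\<bar>" unfolding abs_mult[symmetric] by (rule abs_ge_self)
        also have "\<dots> \<le> \<bar>a k\<bar>" using g by (intro mult_left_le) auto
        finally show "a k * g k \<le> \<bar>a k\<bar>" .
      qed
      also have "\<dots> \<le> 1 / c * norm (\<Sum>k<n. a k *\<^sub>R x k)"
        using lo[where n = n and a = a] c by (simp add: field_simps)
      finally show ?thesis .
    qed
    then obtain f :: "'a \<Rightarrow>\<^sub>L real" where f: "norm f \<le> 1 / c" "\<And>k. blinfun_apply f (x k) = g k"
      using Hahn_Banach_moment[of "1 / c" g x] c by auto
    have "blinfun_apply (Z p) f = sgn (b p)" if "p \<le> d" for p
    proof (rule wstar_cluster_eq[OF Z, of N])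
      fix n assume "N \<le> n"
      then have "N \<le> r p n" by (simp add: r_def)
      moreover have "r p n mod Suc d = p"
        using that unfolding r_def mod_mult_self3 by simp
      ultimately show "blinfun_apply f ((x \<circ> r p) n) = sgn (b p)" by (simp add: f(2) g_def)
    qed
    then have "\<sigma> = blinfun_apply f v"
      unfolding Zv[symmetric] \<sigma>_def by (intro sum.cong) (auto simp: abs_sgn)
    also have "\<dots> = blinfun_apply f (v - y)"
      unfolding a by (simp add: blinfun.diff_right blinfun.sum_right blinfun.scaleR_right f(2) g_def)
    also have "\<dots> \<le> norm f * norm (v - y)"
      using norm_blinfun[of f "v - y"] by simp
    also have "\<dots> \<le> 1 / c * norm (v - y)" using f(1) by (intro mult_right_mono) auto
    also have "\<dots> < 1 / c * (\<sigma> * c)"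
      using y(2) c by (intro mult_strict_left_mono) (auto simp: norm_minus_commute)
    finally show False using c by simp
  qed
  then obtain p where "\<forall>u. \<forall>w\<in>span B. Z p \<noteq> canon u + w" by blast
  with wstar_cluster_subseq[OF Z r_mono] show ?thesis by (rule that)
qed

text \<open>The cluster points are chosen one at a time, each outside the sum of the canonical image
  and the span of \<open>B\<close> with the earlier choices.\<close>

lemma l1_equiv_clusters:
  fixes B :: "(('a::banach \<Rightarrow>\<^sub>L real) \<Rightarrow>\<^sub>L real) set"
  assumes "finite J" and B: "finite B" and disj: "range canon \<inter> span B = {0}"
    and "\<And>i. i \<in> J \<Longrightarrow> l1_equiv (e i)"
  shows "\<exists>z. (\<forall>i\<in>J. wstar_cluster (e i) (z i)) \<and> range canon \<inter> span (z ` J \<union> B) = {0}"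
  using assms(1,4)
proof (induction J)
  case empty
  show ?case using disj by simp
next
  case (insert j J)
  have l1: "l1_equiv (e j)" "\<And>i. i \<in> J \<Longrightarrow> l1_equiv (e i)" using insert.prems by blast+
  from insert.IH[OF l1(2)] obtain z where
    z: "\<forall>i\<in>J. wstar_cluster (e i) (z i)" "range canon \<inter> span (z ` J \<union> B) = {0}"
    by blast
  have fin: "finite (z ` J \<union> B)" using insert.hyps(1) B by simp
  obtain zj where zj: "wstar_cluster (e j) zj"
      "\<forall>u. \<forall>w\<in>span (z ` J \<union> B). zj \<noteq> canon u + w"
    by (rule l1_equiv_cluster_outside[OF fin l1(1)])
  have eq: "(z(j := zj)) ` insert j J \<union> B = insert zj (z ` J \<union> B)"
    using insert.hyps(2) by auto
  show ?case
  proof (intro exI conjI)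
    show "\<forall>i\<in>insert j J. wstar_cluster (e i) ((z(j := zj)) i)"
      using z(1) zj(1) insert.hyps(2) by simp
    show "range canon \<inter> span ((z(j := zj)) ` insert j J \<union> B) = {0}"
      unfolding eq by (rule range_canon_inter_span_insert[OF z(2) zj(2)])
  qed
qed

subsection \<open>Selection of basic sequences\<close>

text \<open>Grunblum's criterion holds with constant \<open>8 / c\<close>. The estimate is made at
  the partial sum of largest norm, since the coefficients, and with them the selection errors, are
  controlled by that maximum and can be absorbed.\<close>

lemma basic_selection:
  fixes e :: "nat \<Rightarrow> nat \<Rightarrow> 'a::banach"
  assumes l: "l \<ge> 1" and \<delta>: "\<delta> > 0" "\<And>i n. i < l \<Longrightarrow> \<delta> \<le> norm (e i n)"
    and cl: "\<And>i. i < l \<Longrightarrow> wstar_cluster (e i) (z i)"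
    and disj: "range canon \<inter> span (z ` {..<l}) = {0}"
  obtains n :: "nat \<Rightarrow> nat" where "strict_mono n" "schauder_basic (\<lambda>m. e (m mod l) (n m))"
proof -
  have ml: "m mod l < l" for m using l by simp
  have sub: "subspace (range (canon :: 'a \<Rightarrow> _))"
    using linear_subspace_image[OF linear_canon subspace_UNIV] .
  have fin: "finite (z ` {..<l})" by simp
  obtain c where c: "c > 0"
    and c_le: "\<And>u w. u \<in> range canon \<Longrightarrow> w \<in> span (z ` {..<l}) \<Longrightarrow> c * norm u \<le> norm (u + w)"
    using finite_dim_complement_bound[OF closed_range_canon sub fin disj] by metis
  \<comment> \<open>All candidates of index below \<open>N\<close>, selected or not. The norming
    sets can therefore be fixed in advance, and the recursion has to remember only the last
    index.\<close>
  define V where "V N = (\<lambda>(i, k). e i k) ` ({..<l} \<times> {..<N})" for N :: nat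
  \<comment> \<open>The constant \<open>c / 4\<close> combines the complement bound \<open>c\<close>
    with the factor \<open>1 / 4\<close> from \<open>finite_dim_norming_set\<close>.\<close>
  define norming where "norming N \<Phi> \<longleftrightarrow> finite \<Phi> \<and> (\<forall>f\<in>\<Phi>. norm f \<le> 1) \<and>
      (\<forall>u\<in>span (V N). \<forall>w\<in>span (z ` {..<l}).
        \<exists>f\<in>\<Phi>. c / 4 * norm u \<le> blinfun_apply f u + blinfun_apply w f)" for N and \<Phi> :: "('a \<Rightarrow>\<^sub>L real) set"
  have "\<exists>\<Phi>. norming N \<Phi>" for N
  proof -
    have fin': "finite (canon ` V N \<union> z ` {..<l})" unfolding V_def by simp
    obtain \<Phi> where \<Phi>: "finite \<Phi>" "\<And>f. f \<in> \<Phi> \<Longrightarrow> norm f \<le> 1"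
      "\<And>w. w \<in> span (canon ` V N \<union> z ` {..<l}) \<Longrightarrow> \<exists>f\<in>\<Phi>. norm w / 4 \<le> blinfun_apply w f"
      using finite_dim_norming_set[OF fin'] by metis
    have "\<exists>f\<in>\<Phi>. c / 4 * norm u \<le> blinfun_apply f u + blinfun_apply w f"
      if u: "u \<in> span (V N)" and w: "w \<in> span (z ` {..<l})" for u w
    proof -
      have "canon u \<in> span (canon ` V N)"
        unfolding linear_span_image[OF linear_canon] using u by (rule imageI)
      then have "canon u \<in> span (canon ` V N \<union> z ` {..<l})"
        by (rule subsetD[OF span_mono, rotated]) simp
      moreover have "w \<in> span (canon ` V N \<union> z ` {..<l})"
        using w by (rule subsetD[OF span_mono, rotated]) simp
      ultimately have "canon u + w \<in> span (canon ` V N \<union> z ` {..<l})" by (rule span_add)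
      from \<Phi>(3)[OF this] obtain f where
        f: "f \<in> \<Phi>" "norm (canon u + w) / 4 \<le> blinfun_apply (canon u + w) f" by blast
      have "c / 4 * norm u \<le> norm (canon u + w) / 4"
        using c_le[OF rangeI w, of u] by simp
      also note f(2)
      finally show ?thesis using f(1) by (auto simp: blinfun.add_left)
    qed
    then have "norming N \<Phi>" using \<Phi>(1,2) unfolding norming_def by blast
    then show ?thesis by blast
  qed
  then have "\<forall>N. \<exists>\<Phi>. norming N \<Phi>" by blast
  from choice[OF this] obtain \<Phi> where "\<And>N. norming N (\<Phi> N)" by blast
  then have \<Phi>: "\<And>N. finite (\<Phi> N)" "\<And>N f. f \<in> \<Phi> N \<Longrightarrow> norm f \<le> 1"
    "\<And>N u w. u \<in> span (V N) \<Longrightarrow> w \<in> span (z ` {..<l}) \<Longrightarrow>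
      \<exists>f\<in>\<Phi> N. c / 4 * norm u \<le> blinfun_apply f u + blinfun_apply w f"
    unfolding norming_def by blast+
  \<comment> \<open>With coefficients up to \<open>2 * M / \<delta>\<close> the total error is at
    most \<open>c * M / 8\<close>, half of the \<open>c * M / 4\<close> supplied by the norming
    functional.\<close>
  define \<epsilon> where "\<epsilon> k = c * \<delta> / 32 * (1 / 2) ^ k" for k :: nat
  have \<epsilon>: "\<epsilon> k > 0" for k using c \<delta> by (simp add: \<epsilon>_def)
  \<comment> \<open>\<open>Suc k\<close> because the vector of index \<open>k\<close> just chosen
    belongs to \<open>V (Suc k)\<close>. All \<open>N\<close> up to it are included so that a later
    vector respects every earlier norming set; the sets \<open>\<Phi> N\<close> need not be
    nested.\<close>
  define step where "step m k k' \<longleftrightarrow> k < k' \<and> (\<forall>N\<le>Suc k. \<forall>f\<in>\<Phi> N.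
      \<bar>blinfun_apply f (e (Suc m mod l) k') - blinfun_apply (z (Suc m mod l)) f\<bar> < \<epsilon> (Suc m))" for m k k'
  have "\<exists>n. \<forall>m. True \<and> step m (n m) (n (Suc m))"
  proof (rule dependent_nat_choice)
    fix k m :: nat
    have fin'': "finite (\<Union>N\<le>Suc k. \<Phi> N)" using \<Phi>(1) by simp
    obtain k' where k': "k' \<ge> Suc k" "\<forall>f\<in>(\<Union>N\<le>Suc k. \<Phi> N).
        \<bar>blinfun_apply f (e (Suc m mod l) k') - blinfun_apply (z (Suc m mod l)) f\<bar> < \<epsilon> (Suc m)"
      by (rule wstar_clusterD[OF cl[OF ml[of "Suc m"]] fin'' \<epsilon>[of "Suc m"], where N = "Suc k"])
    then have "step m k k'" unfolding step_def by auto
    then show "\<exists>k'. True \<and> step m k k'" by blast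
  qed simp
  then obtain n :: "nat \<Rightarrow> nat" where "\<And>m. step m (n m) (n (Suc m))" by blast
  then have n: "\<And>m. n m < n (Suc m)"
    "\<And>m N f. N \<le> Suc (n m) \<Longrightarrow> f \<in> \<Phi> N \<Longrightarrow>
      \<bar>blinfun_apply f (e (Suc m mod l) (n (Suc m))) - blinfun_apply (z (Suc m mod l)) f\<bar> < \<epsilon> (Suc m)"
    unfolding step_def by blast+
  have n_mono: "strict_mono n" using n(1) by (simp add: strict_mono_Suc_iff)
  define x where "x m = e (m mod l) (n m)" for m
  define y where "y m = z (m mod l)" for m
  have close: "\<bar>blinfun_apply f (x k) - blinfun_apply (y k) f\<bar> \<le> \<epsilon> k"
    if "j < k" "f \<in> \<Phi> (Suc (n j))" for j k f
  proof -
    obtain k' where k': "k = Suc k'" "j \<le> k'" using \<open>j < k\<close> by (cases k) auto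
    then have "Suc (n j) \<le> Suc (n k')" using n_mono by (simp add: strict_mono_less_eq)
    from n(2)[OF this that(2)] show ?thesis by (simp add: x_def y_def k'(1))
  qed
  have x_norm: "\<delta> \<le> norm (x k)" for k unfolding x_def by (rule \<delta>(2)[OF ml])
  have "schauder_basic x"
  proof (rule schauder_basicI)
    show "x k \<noteq> 0" for k using x_norm[of k] \<delta>(1) by auto
  next
    fix a :: "nat \<Rightarrow> real" and p N :: nat
    assume "p \<le> N"
    define S where "S m = (\<Sum>k<m. a k *\<^sub>R x k)" for m
    define M where "M = Max ((\<lambda>m. norm (S m)) ` {..N})"
    have M_ge: "norm (S m) \<le> M" if "m \<le> N" for m
      unfolding M_def using that by (intro Max_ge) auto
    have "M \<in> (\<lambda>m. norm (S m)) ` {..N}" unfolding M_def by (intro Max_in) auto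
    then obtain m where m: "m \<le> N" "norm (S m) = M" by auto
    have M0: "M \<ge> 0" using m(2) norm_ge_zero by metis
    have a_le: "\<bar>a k\<bar> \<le> 2 * M / \<delta>" if "k < N" for k
    proof -
      have "\<bar>a k\<bar> * \<delta> \<le> \<bar>a k\<bar> * norm (x k)" by (intro mult_left_mono x_norm) simp
      also have "\<dots> = norm (S (Suc k) - S k)" by (simp add: S_def)
      also have "\<dots> \<le> M + M"
        using that by (intro norm_triangle_le_diff add_mono M_ge) auto
      finally show ?thesis using \<delta>(1) by (simp add: field_simps)
    qed
    have "c / 8 * M \<le> norm (S N)"
    proof (cases m)
      case 0
      then have "M = 0" using m(2) by (simp add: S_def)
      then show ?thesis by simp
    next
      case (Suc j)
      \<comment> \<open>The tail with each vector replaced by its cluster point. As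
        \<open>j = m - 1\<close> is the last position in \<open>S m\<close>, a functional in
        \<open>\<Phi> (Suc (n j))\<close> norms \<open>S m\<close> in the presence of
        \<open>w\<close>, and on the actual tail it differs little from \<open>w\<close>.\<close>
      define w where "w = (\<Sum>k\<in>{m..<N}. a k *\<^sub>R y k)"
      have "S m \<in> span (V (Suc (n j)))"
        unfolding S_def
      proof (intro span_sum span_scale span_base)
        fix k assume "k \<in> {..<m}"
        then have "n k \<le> n j" using Suc n_mono by (simp add: strict_mono_less_eq)
        then have "(k mod l, n k) \<in> {..<l} \<times> {..<Suc (n j)}" using ml by simp
        then show "x k \<in> V (Suc (n j))" unfolding V_def x_def by (rule rev_image_eqI) simp
      qed
      moreover have "w \<in> span (z ` {..<l})"
        unfolding w_def y_def using ml by (intro span_sum span_scale span_base) simp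
      ultimately obtain f where f: "f \<in> \<Phi> (Suc (n j))"
        "c / 4 * norm (S m) \<le> blinfun_apply f (S m) + blinfun_apply w f"
        using \<Phi>(3) by blast
      have "{..<N} = {..<m} \<union> {m..<N}" "{..<m} \<inter> {m..<N} = {}" using m(1) by auto
      then have SN: "S N = S m + (\<Sum>k\<in>{m..<N}. a k *\<^sub>R x k)"
        unfolding S_def by (simp add: sum.union_disjoint)
      have "blinfun_apply w f - blinfun_apply f (\<Sum>k\<in>{m..<N}. a k *\<^sub>R x k)
          = (\<Sum>k\<in>{m..<N}. a k * (blinfun_apply (y k) f - blinfun_apply f (x k)))"
        unfolding w_def
        by (simp add: blinfun.sum_left blinfun.sum_right blinfun.scaleR_left blinfun.scaleR_right
            right_diff_distrib sum_subtractf)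
      also have "\<dots> \<le> (\<Sum>k\<in>{m..<N}. 2 * M / \<delta> * \<epsilon> k)"
      proof (rule sum_mono)
        fix k assume k: "k \<in> {m..<N}"
        have "a k * (blinfun_apply (y k) f - blinfun_apply f (x k))
            \<le> \<bar>a k * (blinfun_apply (y k) f - blinfun_apply f (x k))\<bar>" by (rule abs_ge_self)
        also have "\<dots> = \<bar>a k\<bar> * \<bar>blinfun_apply f (x k) - blinfun_apply (y k) f\<bar>"
          by (simp only: abs_mult abs_minus_commute)
        also have "\<dots> \<le> 2 * M / \<delta> * \<epsilon> k"
          using k Suc M0 \<delta>(1) by (intro mult_mono a_le close[of j] f) auto
        finally show "a k * (blinfun_apply (y k) f - blinfun_apply f (x k)) \<le> 2 * M / \<delta> * \<epsilon> k" .
      qed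
      also have "\<dots> = M * c / 16 * (\<Sum>k\<in>{m..<N}. (1 / 2) ^ k)"
        using \<delta>(1) by (simp add: \<epsilon>_def sum_distrib_left mult.assoc)
      also have "\<dots> \<le> M * c / 16 * 2"
      proof (intro mult_left_mono)
        have "(\<Sum>k\<in>{m..<N}. (1 / 2) ^ k) \<le> (\<Sum>k. (1 / 2 :: real) ^ k)"
          by (intro sum_le_suminf summable_geometric) auto
        then show "(\<Sum>k\<in>{m..<N}. (1 / 2) ^ k) \<le> (2 :: real)"
          by (simp add: suminf_geometric)
      qed (use M0 c in simp)
      finally have "blinfun_apply w f \<le> blinfun_apply f (\<Sum>k\<in>{m..<N}. a k *\<^sub>R x k) + M * c / 8" by simp
      then have "c / 8 * M \<le> blinfun_apply f (S N)"
        using f(2) by (simp add: SN m(2) blinfun.add_right mult.commute[of M c])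
      also have "\<dots> \<le> norm f * norm (S N)" using norm_blinfun[of f "S N"] by simp
      also have "\<dots> \<le> norm (S N)" using \<Phi>(2)[OF f(1)] by (simp add: mult_left_le_one_le)
      finally show ?thesis .
    qed
    then have "M \<le> 8 / c * norm (S N)" using c by (simp add: field_simps)
    then show "norm (\<Sum>k<p. a k *\<^sub>R x k) \<le> 8 / c * norm (\<Sum>k<N. a k *\<^sub>R x k)"
      using M_ge[OF \<open>p \<le> N\<close>] by (simp add: S_def)
  qed
  then show ?thesis using that[OF n_mono] unfolding x_def by blast
qed

section \<open>Weak limits of blocks of a basic plegma enumeration\<close>

lemma plegma_enum_basic_imp_inter_trivial:
  fixes e :: "nat \<Rightarrow> nat \<Rightarrow> 'a::banach"
  assumes l: "l \<ge> 1" and basic: "schauder_basic (plegma_enum l e s)" and s: "plegma l s"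
    and v: "canon v \<in> span {z. \<exists>i<l. wstar_lim (e i) z}"
  shows "v = 0"
proof -
  define x where "x = plegma_enum l e s"
  have x: "x (n * l + i) = e i (s i n)" if "i < l" for n i
    using that by (simp add: x_def plegma_enum_def)
  obtain T r where T: "finite T" "T \<subseteq> {z. \<exists>i<l. wstar_lim (e i) z}" "canon v = (\<Sum>z\<in>T. r z *\<^sub>R z)"
    using v unfolding span_explicit by blast
  then have "\<forall>z\<in>T. \<exists>i. i < l \<and> wstar_lim (e i) z" by blast
  from bchoice[OF this] obtain i where i: "\<And>z. z \<in> T \<Longrightarrow> i z < l" "\<And>z. z \<in> T \<Longrightarrow> wstar_lim (e (i z)) z"
    by blast
  \<comment> \<open>Each limit in the combination is replaced by the member in block
    \<open>n\<close> of a sequence converging to it. Thus \<open>u n\<close> tends weakly to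
    \<open>v\<close>, while its support starts no earlier than position
    \<open>n * l\<close>.\<close>
  define u where "u n = (\<Sum>z\<in>T. r z *\<^sub>R x (n * l + i z))" for n
  have u_lim: "(\<lambda>n. blinfun_apply f (u n)) \<longlonglongrightarrow> blinfun_apply f v" for f :: "'a \<Rightarrow>\<^sub>L real"
  proof -
    have "(\<lambda>n. blinfun_apply f (x (n * l + i z))) \<longlonglongrightarrow> blinfun_apply z f" if z: "z \<in> T" for z
    proof -
      have "(\<lambda>n. blinfun_apply f (e (i z) n)) \<longlonglongrightarrow> blinfun_apply z f"
        using i(2)[OF z] unfolding wstar_lim_def by simp
      moreover have "strict_mono (s (i z))"
        using s i(1)[OF z] unfolding plegma_def by blast
      ultimately have "((\<lambda>n. blinfun_apply f (e (i z) n)) \<circ> s (i z)) \<longlonglongrightarrow> blinfun_apply z f"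
        by (rule LIMSEQ_subseq_LIMSEQ)
      then show ?thesis by (simp add: o_def x[OF i(1)[OF z]])
    qed
    then have "(\<lambda>n. \<Sum>z\<in>T. r z * blinfun_apply f (x (n * l + i z))) \<longlonglongrightarrow> (\<Sum>z\<in>T. r z * blinfun_apply z f)"
      by (intro tendsto_sum tendsto_mult_left)
    moreover have "(\<Sum>z\<in>T. r z * blinfun_apply z f) = blinfun_apply (canon v) f"
      unfolding T(3) by (simp add: blinfun.sum_left blinfun.scaleR_left)
    ultimately show ?thesis
      by (simp add: u_def blinfun.sum_right blinfun.scaleR_right)
  qed
  obtain \<phi> :: "nat \<Rightarrow> 'a \<Rightarrow>\<^sub>L real" where \<phi>: "\<And>j k. blinfun_apply (\<phi> j) (x k) = (if k = j then 1 else 0)"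
    using schauder_basic_biorthogonal[OF basic] unfolding x_def by blast
  have \<phi>_v: "blinfun_apply (\<phi> j) v = 0" for j
  proof (rule LIMSEQ_unique[OF u_lim])
    have "blinfun_apply (\<phi> j) (u n) = 0" if "n \<ge> Suc j" for n
    proof -
      \<comment> \<open>Since \<open>l \<ge> 1\<close>, block \<open>n\<close> lies beyond position
        \<open>j\<close> once \<open>n > j\<close>.\<close>
      have "n \<le> n * l" using l by simp
      then have "n * l + k \<noteq> j" for k using that by linarith
      then show ?thesis by (simp add: u_def blinfun.sum_right blinfun.scaleR_right \<phi>)
    qed
    then show "(\<lambda>n. blinfun_apply (\<phi> j) (u n)) \<longlonglongrightarrow> 0"
      by (intro tendsto_eventually) (auto simp: eventually_sequentially)
  qed
  \<comment> \<open>A subspace has the same weak and norm sequential limits up to closure: a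
    separating functional would vanish at every \<open>u n\<close> but not at
    \<open>v\<close>.\<close>
  have "v \<in> closure (span (range x))"
  proof (rule ccontr)
    assume nv: "v \<notin> closure (span (range x))"
    obtain f :: "'a \<Rightarrow>\<^sub>L real"
      where f: "\<And>y. y \<in> span (range x) \<Longrightarrow> blinfun_apply f y = 0" "blinfun_apply f v = 1"
      by (rule Hahn_Banach_separation[OF subspace_span nv]) blast
    have "blinfun_apply f (u n) = 0" for n
      unfolding u_def by (intro f(1) span_sum span_scale span_base rangeI)
    then have "blinfun_apply f v = 0"
      using LIMSEQ_unique[OF u_lim[of f]] by simp
    then show False using f(2) by simp
  qed
  then obtain a where a: "(\<lambda>k. a k *\<^sub>R x k) sums v"
    using basic unfolding schauder_basic_def x_def by blast
  have "a j = 0" for j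
  proof -
    have "(\<lambda>k. blinfun_apply (\<phi> j) (a k *\<^sub>R x k)) sums blinfun_apply (\<phi> j) v"
      using a by (rule bounded_linear.sums[OF blinfun.bounded_linear_right])
    then have "(\<lambda>k. if k = j then a k else 0) sums 0"
      by (simp add: blinfun.scaleR_right \<phi> \<phi>_v if_distrib cong: if_cong)
    then show ?thesis using sums_single[of j a] sums_unique2 by blast
  qed
  then show "v = 0" using a sums_unique2[OF sums_zero] by simp
qed

section \<open>Assembling both implications for plegma families\<close>

theorem theorem2p12:
  fixes e :: "nat \<Rightarrow> nat \<Rightarrow> 'a::banach" and l :: nat
  assumes "l \<ge> 1"
    and "\<forall>i<l. seminormalized (e i)"
    and "\<forall>i<l. weakly_null (e i) \<or> l1_equiv (e i) \<or> nontrivial_weak_cauchy (e i)"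
  shows "(\<exists>s. plegma l s \<and> schauder_basic (plegma_enum l e s)) \<longleftrightarrow>
         range canon \<inter> span {z. \<exists>i<l. nontrivial_weak_cauchy (e i) \<and> wstar_lim (e i) z} = {0}"
    (is "?basic \<longleftrightarrow> range canon \<inter> span ?L = {0}")
proof
  assume ?basic
  then obtain s where s: "plegma l s" "schauder_basic (plegma_enum l e s)" by blast
  have "?L \<subseteq> {z. \<exists>i<l. wstar_lim (e i) z}" by blast
  then have sub: "span ?L \<subseteq> span {z. \<exists>i<l. wstar_lim (e i) z}" by (rule span_mono)
  have "q = 0" if q: "q \<in> range canon" "q \<in> span ?L" for q
  proof -
    obtain v where v: "q = canon v" using q(1) by blast
    then have "v = 0"
      using plegma_enum_basic_imp_inter_trivial[OF assms(1) s(2,1), of v] q(2) sub by blast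
    then show ?thesis by (simp add: v linear_0[OF linear_canon])
  qed
  moreover have "0 \<in> range canon"
    by (rule range_eqI[of _ _ 0]) (simp add: linear_0[OF linear_canon])
  moreover have "0 \<in> span ?L" by (rule span_zero)
  ultimately show "range canon \<inter> span ?L = {0}" by blast
next
  assume disj: "range canon \<inter> span ?L = {0}"
  define I where "I = {i. i < l \<and> nontrivial_weak_cauchy (e i)}"
  \<comment> \<open>What is left after the weak-Cauchy and weakly null cases; by hypothesis these
    sequences are \<open>l1_equiv\<close>.\<close>
  define J where "J = {i. i < l \<and> \<not> nontrivial_weak_cauchy (e i) \<and> \<not> weakly_null (e i)}"
  have "\<forall>i\<in>I. \<exists>z. wstar_lim (e i) z"
    unfolding I_def nontrivial_weak_cauchy_def by blast
  from bchoice[OF this] obtain z0 where z0: "\<And>i. i \<in> I \<Longrightarrow> wstar_lim (e i) (z0 i)" by blast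
  have fin: "finite I" "finite J" unfolding I_def J_def by simp_all
  have "z0 ` I \<subseteq> ?L" using z0 unfolding I_def by blast
  then have "span (z0 ` I) \<subseteq> span ?L" by (rule span_mono)
  moreover have "0 \<in> span (z0 ` I)" by (rule span_zero)
  ultimately have disj0: "range canon \<inter> span (z0 ` I) = {0}" using disj by blast
  have l1: "l1_equiv (e i)" if "i \<in> J" for i using that assms(3) unfolding J_def by blast
  obtain z1 where z1: "\<forall>i\<in>J. wstar_cluster (e i) (z1 i)" "range canon \<inter> span (z1 ` J \<union> z0 ` I) = {0}"
    using l1_equiv_clusters[OF fin(2) finite_imageI[OF fin(1)] disj0, of e] l1 by blast
  \<comment> \<open>The default \<open>0\<close> falls on the weakly null sequences, where it is the
    weak-star limit and adds nothing to the span.\<close>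
  define z where "z i = (if i \<in> I then z0 i else if i \<in> J then z1 i else 0)" for i
  have z_cl: "wstar_cluster (e i) (z i)" if "i < l" for i
  proof -
    consider "i \<in> I" | "i \<in> J" "i \<notin> I" | "i \<notin> I" "i \<notin> J" by blast
    then show ?thesis
    proof cases
      case 1
      then show ?thesis using wstar_lim_imp_cluster[OF z0] by (simp add: z_def)
    next
      case 2
      then show ?thesis using z1(1) by (simp add: z_def)
    next
      case 3
      then have "weakly_null (e i)" using that unfolding I_def J_def by blast
      then show ?thesis
        using 3 wstar_lim_imp_cluster by (simp add: z_def weakly_null_iff_wstar_lim)
    qed
  qed
  have "z ` {..<l} \<subseteq> span (z1 ` J \<union> z0 ` I)"
    unfolding z_def by (auto intro: span_base span_zero)
  then have "span (z ` {..<l}) \<subseteq> span (z1 ` J \<union> z0 ` I)" by (rule span_minimal) (rule subspace_span)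
  moreover have "0 \<in> span (z ` {..<l})" by (rule span_zero)
  ultimately have disj_z: "range canon \<inter> span (z ` {..<l}) = {0}" using z1(2) by blast
  have "\<forall>i\<in>{..<l}. \<exists>c>0. \<forall>n. c \<le> norm (e i n)"
    using assms(2) unfolding seminormalized_def by blast
  from bchoice[OF this] obtain c where c: "\<And>i. i < l \<Longrightarrow> 0 < c i" "\<And>i n. i < l \<Longrightarrow> c i \<le> norm (e i n)"
    by blast
  define \<delta> where "\<delta> = Min (c ` {..<l})"
  have "0 \<in> {..<l}" using assms(1) by simp
  then have ne: "c ` {..<l} \<noteq> {}" by blast
  have \<delta>: "\<delta> > 0" unfolding \<delta>_def using ne c(1) by (subst Min_gr_iff) auto
  have \<delta>_le: "\<delta> \<le> norm (e i n)" if "i < l" for i n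
  proof -
    have "\<delta> \<le> c i" unfolding \<delta>_def using that by (intro Min_le) auto
    then show ?thesis using c(2)[OF that, of n] by linarith
  qed
  obtain n :: "nat \<Rightarrow> nat" where n: "strict_mono n" "schauder_basic (\<lambda>m. e (m mod l) (n m))"
    by (rule basic_selection[OF assms(1) \<delta> \<delta>_le z_cl disj_z])
  \<comment> \<open>The selection runs through the plegma order, so member \<open>i\<close> of block
    \<open>j\<close> sits at position \<open>j * l + i\<close>, and monotonicity of \<open>n\<close>
    yields all plegma inequalities.\<close>
  define s where "s i j = n (j * l + i)" for i j
  have "plegma l s"
    unfolding plegma_def
  proof (intro conjI allI impI)
    fix i assume "i < l"
    show "strict_mono (s i)"
      unfolding s_def using assms(1)
      by (intro strict_monoI strict_monoD[OF n(1)] add_strict_right_mono mult_less_mono1) auto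
  next
    fix i1 i2 j1 j2 :: nat assume "i1 < l" "i2 < l" "j1 < j2"
    then have "Suc j1 * l \<le> j2 * l" by (intro mult_le_mono1) simp
    then have "j1 * l + i1 < j2 * l + i2" using \<open>i1 < l\<close> by simp
    then show "s i1 j1 < s i2 j2" unfolding s_def by (rule strict_monoD[OF n(1)])
  next
    fix i1 i2 j :: nat assume "i1 < i2 \<and> i2 < l"
    then show "s i1 j \<le> s i2 j"
      unfolding s_def using strict_mono_less_eq[OF n(1)] by simp
  qed
  moreover have "plegma_enum l e s = (\<lambda>m. e (m mod l) (n m))"
    unfolding plegma_enum_def s_def by simp
  ultimately show ?basic using n(2) by metis
qed

end
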